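(* Let $0<q<1$ and let $1<r_2<r_1<1/q$. For integers $m\ge n\ge1$ and $x,y\in\mathbb{Z}$ define $$K_{m,n}(x,y)=\frac1{(2\pi i)^2}\int_{\gamma_{r_2}}\frac{dz}{z}\int_{\gamma_{r_1}}\frac{dw}{w}\,\frac{w}{w-z}\,\frac{z^{x+n}}{w^{y+n}}\,\frac{(1-qz)^m(1-w)^n}{(1-z)^n(1-qw)^m}.$$ Then for any integer $\eta\ge0$ and any integers $m\ge n\ge 1$, $$\mathbb{P}[G(m,n)\le\eta]=\det(I-K_{m,n})_{\ell^2(\{\eta+1,\eta+2,\dots\})},$$ where the right-hand side is the Fredholm determinant of the operator on $\ell^2(\{\eta+1,\eta+2,\dots\})$ with kernel $K_{m,n}(x,y)$.
   Context: $\gamma_r$ denotes the positively oriented circle of radius $r>0$ centered at the origin in $\mathbb{C}$. Last-passage times: let $w(i,j)$, $i,j\ge 1$ integers, be independent geometric random variables with $\mathbb{P}[w(i,j)=k]=(1-q)q^k$ for $k=0,1,2,\dots$. For $m,n\ge 1$ set $G(m,n)=\max_\pi\sum_{(i,j)\in\pi}w(i,j)$, the maximum being over all up/right lattice paths $\pi$ from $(1,1)$ to $(m,n)$. Equivalently, $G(m,n)=\max(G(m-1,n),G(m,n-1))+w(m,n)$ with $G(0,n)=G(n,0)=0$ for $n\ge1$. *)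

theory Defs
  imports
    "HOL-Probability.Probability"
    "HOL-Complex_Analysis.Complex_Analysis"
    "Jordan_Normal_Form.Determinant"
begin

section \<open>Last-passage times\<close>

definition up_right_paths :: "nat \<Rightarrow> nat \<Rightarrow> (nat \<times> nat) list set" where
  "up_right_paths m n =
     {p. p \<noteq> [] \<and> hd p = (1, 1) \<and> last p = (m, n) \<and>
         successively (\<lambda>(i, j) (i', j'). (i', j') = (i + 1, j) \<or> (i', j') = (i, j + 1)) p}"

definition last_passage :: "(nat \<Rightarrow> nat \<Rightarrow> nat) \<Rightarrow> nat \<Rightarrow> nat \<Rightarrow> nat" where
  "last_passage w m n = Max ((\<lambda>p. \<Sum>(i, j)\<in>set p. w i j) ` up_right_paths m n)"

lemma up_right_paths_bounds:
  assumes "p \<in> up_right_paths m n"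
  shows "set p \<subseteq> {1..m} \<times> {1..n} \<and> length p + 1 = m + n"
  using assms
proof (induction p arbitrary: m n rule: rev_induct)
  case Nil
  then show ?case by (simp add: up_right_paths_def)
next
  case (snoc a p)
  have a: "a = (m, n)"
    using snoc.prems by (simp add: up_right_paths_def)
  show ?case
  proof (cases "p = []")
    case True
    then show ?thesis
      using snoc.prems by (auto simp: up_right_paths_def)
  next
    case False
    obtain i j where ij: "last p = (i, j)" by (cases "last p")
    from snoc.prems False a ij have p: "p \<in> up_right_paths i j"
      and step: "(m, n) = (i + 1, j) \<or> (m, n) = (i, j + 1)"
      by (auto simp: up_right_paths_def successively_append_iff)
    have b: "set p \<subseteq> {1..i} \<times> {1..j}" "length p + 1 = i + j"
      using snoc.IH[OF p] by auto
    have "(i, j) \<in> set p"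
      using False ij by (metis last_in_set)
    with b(1) have "1 \<le> i" "1 \<le> j" by auto
    with b step a show ?thesis by fastforce
  qed
qed

lemma finite_up_right_paths: "finite (up_right_paths m n)"
proof (rule finite_subset)
  show "up_right_paths m n \<subseteq> {p. set p \<subseteq> {1..m} \<times> {1..n} \<and> length p \<le> m + n}"
    using up_right_paths_bounds by fastforce
  show "finite {p. set p \<subseteq> {1..m} \<times> {1..n} \<and> length p \<le> m + n}"
    by (rule finite_lists_length_le) simp
qed

lemma up_right_paths_snoc:
  assumes "p \<in> up_right_paths i j" "(m, n) = (i + 1, j) \<or> (m, n) = (i, j + 1)"
  shows "p @ [(m, n)] \<in> up_right_paths m n"
  using assms by (auto simp: up_right_paths_def successively_append_iff)

lemma up_right_paths_nonempty:
  assumes "1 \<le> m" "1 \<le> n"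
  shows "up_right_paths m n \<noteq> {}"
  using assms(2)
proof (induction n rule: dec_induct)
  case base
  show ?case using assms(1)
  proof (induction m rule: dec_induct)
    case base
    have "[(1, 1)] \<in> up_right_paths 1 1" by (simp add: up_right_paths_def)
    then show ?case by blast
  next
    case (step m)
    then show ?case using up_right_paths_snoc[of _ m 1 "Suc m" 1] by fastforce
  qed
next
  case (step n)
  then show ?case using up_right_paths_snoc[of _ m n m "Suc n"] by fastforce
qed


section \<open>Fredholm determinants on discrete sets\<close>

text \<open>
  The Fredholm determinant of a kernel on \<open>\<ell>\<^sup>2(S)\<close> is given by its Fredholm expansion
  \<open>det (I - K) = \<Sum>k. (-1)^k / k! \<Sum>x\<^sub>0, \<dots>, x\<^sub>k\<^sub>-\<^sub>1 \<in> S. det (K x\<^sub>i x\<^sub>j)\<close>.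
  The expansion is invariant under conjugating \<open>K x y\<close> to \<open>\<rho> y / \<rho> x * K x y\<close>. This matters
  here: the last-passage kernel below does not decay in \<open>x\<close> (for \<open>m = n = 1\<close> and \<open>y \<ge> 0\<close>,
  \<open>x \<ge> 0\<close> it equals \<open>(1 - q) q^y\<close>), so it acts on \<open>\<ell>\<^sup>2\<close> only after such a conjugation.
\<close>

definition kernel_minor :: "('a \<Rightarrow> 'a \<Rightarrow> complex) \<Rightarrow> nat \<Rightarrow> (nat \<Rightarrow> 'a) \<Rightarrow> complex" where
  "kernel_minor K k x = Determinant.det (mat k k (\<lambda>(i, j). K (x i) (x j)))"

definition fredholm_det :: "('a \<Rightarrow> 'a \<Rightarrow> complex) \<Rightarrow> 'a set \<Rightarrow> complex" where
  "fredholm_det K S =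
     (\<Sum>k. (-1) ^ k / fact k * (\<Sum>\<^sub>\<infinity>x\<in>{..<k} \<rightarrow>\<^sub>E S. kernel_minor K k x))"

text \<open>
  Infinite sums default to arbitrary values when they diverge; the following says that the
  Fredholm expansion converges absolutely, as a double sum over \<open>k\<close> and \<open>x\<close>.
\<close>

definition fredholm_convergent :: "('a \<Rightarrow> 'a \<Rightarrow> complex) \<Rightarrow> 'a set \<Rightarrow> bool" where
  "fredholm_convergent K S \<longleftrightarrow>
     (\<forall>k. (\<lambda>x. norm (kernel_minor K k x)) summable_on ({..<k} \<rightarrow>\<^sub>E S)) \<and>
     summable (\<lambda>k. (\<Sum>\<^sub>\<infinity>x\<in>{..<k} \<rightarrow>\<^sub>E S. norm (kernel_minor K k x)) / fact k)"


section \<open>The kernel\<close>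

definition lpp_kernel ::
  "real \<Rightarrow> real \<Rightarrow> real \<Rightarrow> nat \<Rightarrow> nat \<Rightarrow> int \<Rightarrow> int \<Rightarrow> complex" where
  "lpp_kernel q r1 r2 m n x y =
     1 / (2 * of_real pi * \<i>)\<^sup>2 *
     contour_integral (circlepath 0 r2) (\<lambda>z. 1 / z *
       contour_integral (circlepath 0 r1) (\<lambda>w. 1 / w *
         (w / (w - z) * (z powi (x + int n) / w powi (y + int n)) *
          (((1 - of_real q * z) ^ m * (1 - w) ^ n) /
           ((1 - z) ^ n * (1 - of_real q * w) ^ m)))))"

end

theory Submission
  imports Defs
begin

text \<open>
  The proof computes \<open>P[G(m, n) \<le> \<eta>]\<close> as an \<open>n \<times> n\<close> determinant and recognises this determinant as
  the Fredholm determinant of a kernel of rank \<open>n\<close>. Write \<open>D f x = f (x + 1) - f x\<close> for the forward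
  difference and \<open>c\<^sub>m\<close> for the sequence with generating function \<open>1 / (1 - q X)\<^sup>m\<close>, so that
  \<open>(1 - q)\<^sup>m c\<^sub>m\<close> is the negative binomial distribution.

  \<^emph>\<open>The law of a column.\<close> For fixed \<open>m\<close>, the vector \<open>(G(m, 1), \<dots>, G(m, n))\<close> has the density
  \<open>det [(1 - q)\<^sup>m D\<^sup>j\<^sup>-\<^sup>i c\<^sub>m (x\<^sub>j)]\<close> on the chains \<open>0 \<le> x\<^sub>1 \<le> \<dots> \<le> x\<^sub>n\<close>. This is proved by induction on \<open>m\<close>
  (\<open>lpp_column_density\<close>). The next column satisfies \<open>y\<^sub>j = max y\<^sub>j\<^sub>-\<^sub>1 x\<^sub>j + w\<^sub>j\<close>, so its density is a sum over chains
  \<open>x\<close> of the old determinant times factors that each depend on one \<open>x\<^sub>j\<close> only. Summing over \<open>x\<^sub>n\<close>, then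
  \<open>x\<^sub>n\<^sub>-\<^sub>1\<close> and so on, the only trace of the constraint \<open>x\<^sub>j \<ge> x\<^sub>j\<^sub>-\<^sub>1\<close> is a boundary term proportional to the
  row \<open>j - 1\<close> of the determinant, which contributes nothing (\<open>sum_chains_det\<close>). The same argument with
  constant factors yields \<open>P[G(m, n) \<le> \<eta>] = det [(1 - q)\<^sup>m D\<^sup>j\<^sup>-\<^sup>i\<^sup>-\<^sup>1 c\<^sub>m (\<eta> + 1)]\<close>.

  \<^emph>\<open>Biorthogonality.\<close> Unitriangular column operations turn this matrix into
  \<open>[\<Sum>x\<le>\<eta>. \<psi>\<^sub>j x * \<phi>\<^sub>i x]\<close>, where \<open>\<psi>\<^sub>j = D\<^sup>j c\<^sub>m\<close> and \<open>\<phi>\<^sub>i x\<close> (for \<open>i, j < n\<close>) is the coefficient of \<open>v\<^sup>i\<close> in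
  \<open>(1 + v)\<^sup>-\<^sup>x (1 - q / (1 + v))\<^sup>m\<close>. Since \<open>\<Sum>x. \<psi>\<^sub>j x * \<phi>\<^sub>i x = \<delta>\<^sub>i\<^sub>j\<close> over all integers (\<open>has_sum_psi_phi\<close>), the
  matrix is the identity minus the same sums over \<open>x > \<eta>\<close>.

  \<^emph>\<open>The kernel.\<close> In the variables \<open>u = 1 / w - 1\<close> and \<open>v = 1 / z - 1\<close> the factor \<open>1 / (w - z)\<close> is a
  geometric series in \<open>v / u\<close>. The factor \<open>1 / (1 - z)\<^sup>n\<close> is a pole of order \<open>n\<close> at \<open>v = 0\<close>, so the first \<open>n\<close>
  terms suffice, and \<open>K x y = \<Sum>i<n. \<phi>\<^sub>i x * \<psi>\<^sub>i y\<close> (\<open>lpp_kernel_eq_sum\<close>). The Fredholm determinant of such a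
  kernel is \<open>det (\<delta>\<^sub>i\<^sub>j - \<Sum>x>\<eta>. \<psi>\<^sub>i x * \<phi>\<^sub>j x)\<close> (\<open>fredholm_det_finite_rank\<close>), which is the determinant above.
\<close>

section \<open>Fredholm determinants of kernels of finite rank\<close>

text \<open>
  The Leibniz formula indexed by a set \<open>J\<close> instead of an initial segment of the naturals, so that
  the minors on different index sets can be compared without enumerating them.
\<close>

definition principal_minor :: "'b set \<Rightarrow> ('b \<Rightarrow> 'b \<Rightarrow> 'c::comm_ring_1) \<Rightarrow> 'c" where
  "principal_minor J M = (\<Sum>\<sigma> | \<sigma> permutes J. of_int (sign \<sigma>) * (\<Prod>i\<in>J. M i (\<sigma> i)))"

lemma det_eq_principal_minor:
  "Determinant.det (mat k k (\<lambda>(i, j). M i j)) = principal_minor {..<k} M"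
  unfolding principal_minor_def
  by (subst det_def'[where n = k])
     (auto simp: atLeast0LessThan permutes_in_image intro!: sum.cong prod.cong)

text \<open>
  Relabelling the indices conjugates every permutation by \<open>l\<close>, which preserves its sign.
\<close>

lemma principal_minor_bij:
  assumes l: "bij_betw l A J" and fin: "finite A"
  shows "principal_minor A (\<lambda>i j. M (l i) (l j)) = principal_minor J M"
proof -
  have inj: "inj_on l A" and im: "l ` A = J"
    using l by (auto simp: bij_betw_def)
  have "principal_minor J M =
      (\<Sum>\<sigma> | \<sigma> permutes A. of_int (sign (map_permutation A l \<sigma>)) *
         (\<Prod>i\<in>J. M i (map_permutation A l \<sigma> i)))"
    unfolding principal_minor_def
  proof (rule sum.reindex_bij_witness[of _ "map_permutation A l" "map_permutation J (inv_into A l)"])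
    fix \<sigma> assume "\<sigma> \<in> {\<sigma>. \<sigma> permutes J}"
    then have \<sigma>: "\<sigma> permutes J" by simp
    have b: "bij_betw (inv_into A l) J A" using l by (rule bij_betw_inv_into)
    show "map_permutation J (inv_into A l) \<sigma> \<in> {\<sigma>. \<sigma> permutes A}"
      using map_permutation_permutes[OF b \<sigma>] by simp
    show "map_permutation A l (map_permutation J (inv_into A l) \<sigma>) = \<sigma>"
      by (rule map_permutation_compose_inv[OF b \<sigma>]) (use im in \<open>auto intro: f_inv_into_f\<close>)
    then show "of_int (sign (map_permutation A l (map_permutation J (inv_into A l) \<sigma>))) *
         (\<Prod>i\<in>J. M i (map_permutation A l (map_permutation J (inv_into A l) \<sigma>) i)) =
       of_int (sign \<sigma>) * (\<Prod>i\<in>J. M i (\<sigma> i))" by simp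
  next
    fix \<sigma> assume "\<sigma> \<in> {\<sigma>. \<sigma> permutes A}"
    then have \<sigma>: "\<sigma> permutes A" by simp
    show "map_permutation A l \<sigma> \<in> {\<sigma>. \<sigma> permutes J}"
      using map_permutation_permutes[OF l \<sigma>] by simp
    show "map_permutation J (inv_into A l) (map_permutation A l \<sigma>) = \<sigma>"
      by (rule map_permutation_compose_inv[OF l \<sigma>]) (use inj in auto)
  qed
  also have "\<dots> = principal_minor A (\<lambda>i j. M (l i) (l j))"
    unfolding principal_minor_def
  proof (intro sum.cong refl)
    fix \<sigma> assume "\<sigma> \<in> {\<sigma>. \<sigma> permutes A}"
    then have \<sigma>: "\<sigma> permutes A" by simp
    have "(\<Prod>i\<in>J. M i (map_permutation A l \<sigma> i)) = (\<Prod>i\<in>A. M (l i) (map_permutation A l \<sigma> (l i)))"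
      using prod.reindex_bij_betw[OF l, of "\<lambda>i. M i (map_permutation A l \<sigma> i)"] by simp
    also have "\<dots> = (\<Prod>i\<in>A. M (l i) (l (\<sigma> i)))"
      by (intro prod.cong refl) (simp add: map_permutation_apply[OF inj])
    finally show "of_int (sign (map_permutation A l \<sigma>)) * (\<Prod>i\<in>J. M i (map_permutation A l \<sigma> i)) =
       of_int (sign \<sigma>) * (\<Prod>i\<in>A. M (l i) (l (\<sigma> i)))"
      using sign_map_permutation[OF inj \<sigma> fin] by simp
  qed
  finally show ?thesis by simp
qed

lemma principal_minor_not_inj:
  fixes k :: nat
  assumes "l \<in> {..<k} \<rightarrow> J" "\<not> inj_on l {..<k}"
  shows "principal_minor {..<k} (\<lambda>i j. M (l i) j) = 0"
proof -
  obtain a b where ab: "a < k" "b < k" "a \<noteq> b" "l a = l b"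
    using assms(2) by (auto simp: inj_on_def)
  have "Determinant.det (mat k k (\<lambda>(i, j). M (l i) j)) = 0"
    by (rule det_identical_rows[where n = k and i = a and j = b]) (use ab in \<open>auto intro!: eq_vecI\<close>)
  then show ?thesis by (simp add: det_eq_principal_minor)
qed

text \<open>
  Expanding \<open>\<Prod>i. \<delta> - M\<close> inside the Leibniz formula chooses a set \<open>J\<close> of rows that use \<open>- M\<close>. The
  Kronecker deltas on the other rows force the permutation to fix them, so it permutes \<open>J\<close>.
\<close>

lemma det_one_minus_eq_sum_principal_minors:
  "Determinant.det (mat n n (\<lambda>(i, j). (if i = j then 1 else 0) - M i j)) =
     (\<Sum>J\<in>Pow {..<n}. (-1) ^ card J * principal_minor J M)"
proof -
  define P where "P = {\<sigma>. \<sigma> permutes {..<n}}"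
  have finP: "finite P" unfolding P_def by (simp add: finite_permutations)
  have "Determinant.det (mat n n (\<lambda>(i, j). (if i = j then 1 else 0) - M i j)) =
      (\<Sum>\<sigma>\<in>P. of_int (sign \<sigma>) * (\<Prod>i<n. - M i (\<sigma> i) + (if i = \<sigma> i then 1 else 0)))"
    unfolding det_eq_principal_minor principal_minor_def P_def by simp
  also have "\<dots> = (\<Sum>\<sigma>\<in>P. of_int (sign \<sigma>) * (\<Sum>J\<in>Pow {..<n}. (\<Prod>i\<in>J. - M i (\<sigma> i)) *
      (\<Prod>i\<in>{..<n}-J. if i = \<sigma> i then 1 else 0)))"
    by (subst prod_add) auto
  also have "\<dots> = (\<Sum>J\<in>Pow {..<n}. \<Sum>\<sigma>\<in>P. of_int (sign \<sigma>) * ((\<Prod>i\<in>J. - M i (\<sigma> i)) *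
      (\<Prod>i\<in>{..<n}-J. if i = \<sigma> i then 1 else 0)))"
    unfolding sum_distrib_left by (rule sum.swap)
  also have "\<dots> = (\<Sum>J\<in>Pow {..<n}. (-1) ^ card J * principal_minor J M)"
  proof (intro sum.cong refl)
    fix J assume "J \<in> Pow {..<n}"
    then have J: "J \<subseteq> {..<n}" by simp
    have "(\<Sum>\<sigma>\<in>P. of_int (sign \<sigma>) * ((\<Prod>i\<in>J. - M i (\<sigma> i)) *
      (\<Prod>i\<in>{..<n}-J. if i = \<sigma> i then 1 else 0))) =
      (\<Sum>\<sigma> | \<sigma> permutes J. of_int (sign \<sigma>) * ((\<Prod>i\<in>J. - M i (\<sigma> i)) *
      (\<Prod>i\<in>{..<n}-J. if i = \<sigma> i then 1 else 0)))"
    proof (rule sum.mono_neutral_right[OF finP])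
      show "{\<sigma>. \<sigma> permutes J} \<subseteq> P"
        unfolding P_def using J permutes_subset by blast
      show "\<forall>\<sigma>\<in>P - {\<sigma>. \<sigma> permutes J}. of_int (sign \<sigma>) * ((\<Prod>i\<in>J. - M i (\<sigma> i)) *
        (\<Prod>i\<in>{..<n}-J. if i = \<sigma> i then 1 else 0)) = 0"
      proof
        fix \<sigma> assume "\<sigma> \<in> P - {\<sigma>. \<sigma> permutes J}"
        then have \<sigma>: "\<sigma> permutes {..<n}" "\<not> \<sigma> permutes J" by (auto simp: P_def)
        then obtain i where i: "i \<in> {..<n} - J" "\<sigma> i \<noteq> i"
          using permutes_superset[OF \<sigma>(1), of J] by auto
        have "(\<Prod>i\<in>{..<n}-J. if i = \<sigma> i then 1 else 0) = (0::'a)"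
          by (rule prod_zero) (use i in \<open>auto intro!: bexI[of _ i]\<close>)
        then show "of_int (sign \<sigma>) * ((\<Prod>i\<in>J. - M i (\<sigma> i)) *
        (\<Prod>i\<in>{..<n}-J. if i = \<sigma> i then 1 else 0)) = 0" by simp
      qed
    qed
    also have "\<dots> = (\<Sum>\<sigma> | \<sigma> permutes J. (-1) ^ card J * (of_int (sign \<sigma>) * (\<Prod>i\<in>J. M i (\<sigma> i))))"
    proof (intro sum.cong refl)
      fix \<sigma> assume "\<sigma> \<in> {\<sigma>. \<sigma> permutes J}"
      then have "(\<Prod>i\<in>{..<n}-J. if i = \<sigma> i then 1 else 0) = (1::'a)"
        by (intro prod.neutral) (auto simp: permutes_def)
      then show "of_int (sign \<sigma>) * ((\<Prod>i\<in>J. - M i (\<sigma> i)) *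
        (\<Prod>i\<in>{..<n}-J. if i = \<sigma> i then 1 else 0)) =
        (-1) ^ card J * (of_int (sign \<sigma>) * (\<Prod>i\<in>J. M i (\<sigma> i)))"
        by (simp add: prod_uminus ac_simps)
    qed
    finally show "(\<Sum>\<sigma>\<in>P. of_int (sign \<sigma>) * ((\<Prod>i\<in>J. - M i (\<sigma> i)) *
      (\<Prod>i\<in>{..<n}-J. if i = \<sigma> i then 1 else 0))) = (-1) ^ card J * principal_minor J M"
      by (simp add: principal_minor_def sum_distrib_left)
  qed
  finally show ?thesis .
qed

text \<open>
  A tuple with a repeated index has two equal rows and contributes \<open>0\<close>; each set of size \<open>k\<close> is the
  image of \<open>k!\<close> injective tuples. The factor \<open>k!\<close> cancels the one in the Fredholm expansion.
\<close>

lemma sum_minors_eq_principal_minors: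
  fixes M :: "nat \<Rightarrow> nat \<Rightarrow> 'c::comm_ring_1"
  shows "(\<Sum>l\<in>{..<k} \<rightarrow>\<^sub>E {..<n}. principal_minor {..<k} (\<lambda>i j. M (l i) (l j))) =
     of_nat (fact k) * (\<Sum>J | J \<subseteq> {..<n} \<and> card J = k. principal_minor J M)"
proof -
  define L where "L = {l \<in> {..<k} \<rightarrow>\<^sub>E {..<n}. inj_on l {..<k}}"
  have finE: "finite ({..<k} \<rightarrow>\<^sub>E {..<n})" by (intro finite_PiE) auto
  have finL: "finite L" using finE unfolding L_def by simp
  have "(\<Sum>l\<in>{..<k} \<rightarrow>\<^sub>E {..<n}. principal_minor {..<k} (\<lambda>i j. M (l i) (l j))) =
        (\<Sum>l\<in>L. principal_minor {..<k} (\<lambda>i j. M (l i) (l j)))"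
  proof (rule sum.mono_neutral_right[OF finE])
    show "L \<subseteq> {..<k} \<rightarrow>\<^sub>E {..<n}" by (auto simp: L_def)
    show "\<forall>l\<in>({..<k} \<rightarrow>\<^sub>E {..<n}) - L. principal_minor {..<k} (\<lambda>i j. M (l i) (l j)) = 0"
    proof
      fix l assume "l \<in> ({..<k} \<rightarrow>\<^sub>E {..<n}) - L"
      then have l: "l \<in> {..<k} \<rightarrow> {..<n}" "\<not> inj_on l {..<k}" by (auto simp: L_def)
      show "principal_minor {..<k} (\<lambda>i j. M (l i) (l j)) = 0"
        using principal_minor_not_inj[OF l, of "\<lambda>a j. M a (l j)"] by simp
    qed
  qed
  also have "\<dots> = (\<Sum>l\<in>L. principal_minor (l ` {..<k}) M)"
    by (intro sum.cong refl principal_minor_bij) (auto simp: L_def bij_betw_def)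
  also have "\<dots> = (\<Sum>J | J \<subseteq> {..<n} \<and> card J = k. \<Sum>l | l \<in> L \<and> l ` {..<k} = J. principal_minor (l ` {..<k}) M)"
  proof (rule sum.group[symmetric, OF finL])
    show "finite {J. J \<subseteq> {..<n} \<and> card J = k}"
      by (rule finite_subset[of _ "Pow {..<n}"]) auto
    show "(\<lambda>l. l ` {..<k}) ` L \<subseteq> {J. J \<subseteq> {..<n} \<and> card J = k}"
      by (force simp: L_def card_image)
  qed
  also have "\<dots> = (\<Sum>J | J \<subseteq> {..<n} \<and> card J = k. of_nat (fact k) * principal_minor J M)"
  proof (intro sum.cong refl)
    fix J assume "J \<in> {J. J \<subseteq> {..<n} \<and> card J = k}"
    then have J: "J \<subseteq> {..<n}" "card J = k" by auto
    then have finJ: "finite J" using finite_subset by blast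
    have "{l. l \<in> L \<and> l ` {..<k} = J} = {l \<in> {..<k} \<rightarrow>\<^sub>E J. inj_on l {..<k}}"
    proof (intro equalityI subsetI)
      fix l assume "l \<in> {l. l \<in> L \<and> l ` {..<k} = J}"
      then show "l \<in> {l \<in> {..<k} \<rightarrow>\<^sub>E J. inj_on l {..<k}}" by (auto simp: L_def PiE_iff)
    next
      fix l assume l: "l \<in> {l \<in> {..<k} \<rightarrow>\<^sub>E J. inj_on l {..<k}}"
      then have "l ` {..<k} = J"
        by (intro card_subset_eq[OF finJ]) (auto simp: card_image J)
      then show "l \<in> {l. l \<in> L \<and> l ` {..<k} = J}" using l J by (auto simp: L_def PiE_iff)
    qed
    then have "card {l. l \<in> L \<and> l ` {..<k} = J} = fact k"
      using card_inj_on_subset_funcset[of "{..<k}" J "{..<k}"] finJ J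
      by (simp add: fact_prod_rev)
    then show "(\<Sum>l | l \<in> L \<and> l ` {..<k} = J. principal_minor (l ` {..<k}) M) = of_nat (fact k) * principal_minor J M"
      by simp
  qed
  finally show ?thesis by (simp add: sum_distrib_left)
qed

lemma has_sum_finite_sum:
  fixes f :: "'b \<Rightarrow> 'a \<Rightarrow> 'c::topological_comm_monoid_add"
  assumes "\<And>i. i \<in> I \<Longrightarrow> (f i has_sum s i) A"
  shows "((\<lambda>x. \<Sum>i\<in>I. f i x) has_sum (\<Sum>i\<in>I. s i)) A"
  using assms
proof (induction I rule: infinite_finite_induct)
  case (insert a F)
  then show ?case by (auto intro: has_sum_add)
qed (simp_all add: has_sum_0)

text \<open>
  Half of the Cauchy-Binet formula: only the sum over the left factors is expanded. In this form
  the minor visibly vanishes for \<open>k > n\<close>, since then no \<open>l\<close> is injective.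
\<close>

lemma kernel_minor_finite_rank:
  fixes n :: nat
  assumes K: "\<And>x y. x \<in> S \<Longrightarrow> y \<in> S \<Longrightarrow> K x y = (\<Sum>l<n. g l x * p l y)"
    and x: "x \<in> {..<k} \<rightarrow>\<^sub>E S"
  shows "kernel_minor K k x =
    (\<Sum>l\<in>{..<k} \<rightarrow>\<^sub>E {..<n}. (\<Prod>i<k. g (l i) (x i)) * principal_minor {..<k} (\<lambda>i j. p (l i) (x j)))"
proof -
  have "kernel_minor K k x =
     (\<Sum>\<sigma> | \<sigma> permutes {..<k}. of_int (sign \<sigma>) * (\<Prod>i<k. \<Sum>l<n. g l (x i) * p l (x (\<sigma> i))))"
    unfolding kernel_minor_def det_eq_principal_minor principal_minor_def
  proof (intro sum.cong refl arg_cong2[where f = "(*)"] prod.cong)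
    fix \<sigma> i assume "\<sigma> \<in> {\<sigma>. \<sigma> permutes {..<k}}" "i \<in> {..<k}"
    then have "\<sigma> i \<in> {..<k}" using permutes_in_image by fastforce
    then show "K (x i) (x (\<sigma> i)) = (\<Sum>l<n. g l (x i) * p l (x (\<sigma> i)))"
      using x \<open>i \<in> {..<k}\<close> by (intro K) auto
  qed
  also have "\<dots> = (\<Sum>\<sigma> | \<sigma> permutes {..<k}. \<Sum>l\<in>{..<k} \<rightarrow>\<^sub>E {..<n}.
      (\<Prod>i<k. g (l i) (x i)) * (of_int (sign \<sigma>) * (\<Prod>i<k. p (l i) (x (\<sigma> i)))))"
    by (subst prod_sum_PiE) (simp_all add: prod.distrib sum_distrib_left ac_simps)
  also have "\<dots> = (\<Sum>l\<in>{..<k} \<rightarrow>\<^sub>E {..<n}. \<Sum>\<sigma> | \<sigma> permutes {..<k}.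
      (\<Prod>i<k. g (l i) (x i)) * (of_int (sign \<sigma>) * (\<Prod>i<k. p (l i) (x (\<sigma> i)))))"
    by (rule sum.swap)
  finally show ?thesis by (simp add: principal_minor_def sum_distrib_left)
qed

text \<open>
  The identity \<open>det (I - \<Phi> \<Psi>) = det (I - \<Psi> \<Phi>)\<close> for factors of rank \<open>n\<close>. In each term of the expanded
  \<open>k\<close>-fold minor the variables \<open>x\<^sub>i\<close> separate, so the sum over \<open>x\<close> turns it into the \<open>k\<close>-fold minor of
  the \<open>n \<times> n\<close> matrix \<open>M\<close>, and the Fredholm expansion becomes the expansion of \<open>det (1 - M)\<close>.
\<close>

lemma fredholm_det_finite_rank:
  fixes K :: "'a \<Rightarrow> 'a \<Rightarrow> complex" and n :: nat
  assumes K: "\<And>x y. x \<in> S \<Longrightarrow> y \<in> S \<Longrightarrow> K x y = (\<Sum>l<n. g l x * p l y)"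
    and S: "countable S"
    and sm: "\<And>i j. i < n \<Longrightarrow> j < n \<Longrightarrow> (\<lambda>x. norm (p i x * g j x)) summable_on S"
  shows "fredholm_convergent K S"
    and "fredholm_det K S =
       Determinant.det (mat n n (\<lambda>(i, j). (if i = j then 1 else 0) - (\<Sum>\<^sub>\<infinity>x\<in>S. p i x * g j x)))"
proof -
  define M where "M i j = (\<Sum>\<^sub>\<infinity>x\<in>S. p i x * g j x)" for i j
  define T where "T \<sigma> l x k = (\<Prod>i<k. p (l (Hilbert_Choice.inv \<sigma> i)) (x i) * g (l i) (x i))"
    for \<sigma> :: "nat \<Rightarrow> nat" and l :: "nat \<Rightarrow> nat" and x :: "nat \<Rightarrow> 'a" and k :: nat
  have finE: "finite ({..<k} \<rightarrow>\<^sub>E {..<n})" for k :: nat by (intro finite_PiE) auto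
  have minor: "kernel_minor K k x =
    (\<Sum>l\<in>{..<k} \<rightarrow>\<^sub>E {..<n}. (\<Prod>i<k. g (l i) (x i)) * principal_minor {..<k} (\<lambda>i j. p (l i) (x j)))"
    if "x \<in> {..<k} \<rightarrow>\<^sub>E S" for k x
    by (rule kernel_minor_finite_rank[where S = S]) (use K that in auto)
  have expand: "kernel_minor K k x = (\<Sum>l\<in>{..<k} \<rightarrow>\<^sub>E {..<n}.
      \<Sum>\<sigma> | \<sigma> permutes {..<k}. of_int (sign \<sigma>) * T \<sigma> l x k)"
    if "x \<in> {..<k} \<rightarrow>\<^sub>E S" for k x
    unfolding minor[OF that] principal_minor_def sum_distrib_left
  proof (intro sum.cong refl)
    fix l :: "nat \<Rightarrow> nat" and \<sigma> assume "\<sigma> \<in> {\<sigma>. \<sigma> permutes {..<k}}"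
    then have \<sigma>: "\<sigma> permutes {..<k}" by simp
    have "(\<Prod>i<k. p (l i) (x (\<sigma> i))) = (\<Prod>i<k. p (l (Hilbert_Choice.inv \<sigma> (\<sigma> i))) (x (\<sigma> i)))"
      using permutes_inverses(2)[OF \<sigma>] by simp
    also have "\<dots> = (\<Prod>i<k. p (l (Hilbert_Choice.inv \<sigma> i)) (x i))"
      using prod.permute[OF \<sigma>, of "\<lambda>i. p (l (Hilbert_Choice.inv \<sigma> i)) (x i)"] by (simp add: o_def)
    finally show "(\<Prod>i<k. g (l i) (x i)) * (of_int (sign \<sigma>) * (\<Prod>i<k. p (l i) (x (\<sigma> i)))) =
       of_int (sign \<sigma>) * T \<sigma> l x k"
      by (simp add: T_def prod.distrib)
  qed
  have inv_mem: "Hilbert_Choice.inv \<sigma> i < k" if "\<sigma> permutes {..<k}" "i < k" for \<sigma> and i k :: nat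
    using permutes_in_image[OF permutes_inv[OF that(1)], of i] that(2) by simp
  have smT: "(\<lambda>x. norm (T \<sigma> l x k)) summable_on ({..<k} \<rightarrow>\<^sub>E S)"
    if "l \<in> {..<k} \<rightarrow>\<^sub>E {..<n}" "\<sigma> permutes {..<k}" for k l \<sigma>
    unfolding T_def abs_summable_equivalent
  proof (rule abs_summable_on_prod_PiE)
    fix i assume "i \<in> {..<k}"
    then show "Infinite_Set_Sum.abs_summable_on (\<lambda>x. p (l (Hilbert_Choice.inv \<sigma> i)) x * g (l i) x) S"
      using that inv_mem by (intro sm[unfolded abs_summable_equivalent]) (auto simp: PiE_iff)
  qed (simp_all add: S)
  have infT: "(\<Sum>\<^sub>\<infinity>x\<in>{..<k} \<rightarrow>\<^sub>E S. T \<sigma> l x k) = (\<Prod>i<k. M (l i) (l (\<sigma> i)))"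
    if l: "l \<in> {..<k} \<rightarrow>\<^sub>E {..<n}" and \<sigma>: "\<sigma> permutes {..<k}" for k l \<sigma>
  proof -
    have "(\<Sum>\<^sub>\<infinity>x\<in>{..<k} \<rightarrow>\<^sub>E S. T \<sigma> l x k) = (\<Prod>i<k. M (l (Hilbert_Choice.inv \<sigma> i)) (l i))"
      unfolding T_def M_def
      by (rule infsum_prod_PiE_abs) (use l \<sigma> inv_mem in \<open>auto intro!: sm simp: PiE_iff\<close>)
    also have "\<dots> = (\<Prod>i<k. M (l (Hilbert_Choice.inv \<sigma> (\<sigma> i))) (l (\<sigma> i)))"
      using prod.permute[OF \<sigma>, of "\<lambda>i. M (l (Hilbert_Choice.inv \<sigma> i)) (l i)"] by (simp add: o_def)
    finally show ?thesis using permutes_inverses(2)[OF \<sigma>] by simp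
  qed
  have smT': "(\<lambda>x. T \<sigma> l x k) summable_on ({..<k} \<rightarrow>\<^sub>E S)"
    if "l \<in> {..<k} \<rightarrow>\<^sub>E {..<n}" "\<sigma> permutes {..<k}" for k l \<sigma>
    using smT[OF that] by (rule abs_summable_summable)
  have sm_minor: "(\<lambda>x. norm (kernel_minor K k x)) summable_on ({..<k} \<rightarrow>\<^sub>E S)" for k
  proof (rule summable_on_comparison_test)
    show "(\<lambda>x. \<Sum>l\<in>{..<k} \<rightarrow>\<^sub>E {..<n}. \<Sum>\<sigma> | \<sigma> permutes {..<k}. norm (T \<sigma> l x k))
       summable_on ({..<k} \<rightarrow>\<^sub>E S)"
      by (rule has_sum_imp_summable, (rule has_sum_finite_sum)+, rule has_sum_infsum, rule smT) auto
    fix x assume x: "x \<in> {..<k} \<rightarrow>\<^sub>E S"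
    show "norm (kernel_minor K k x) \<le>
       (\<Sum>l\<in>{..<k} \<rightarrow>\<^sub>E {..<n}. \<Sum>\<sigma> | \<sigma> permutes {..<k}. norm (T \<sigma> l x k))"
      unfolding expand[OF x]
      by (intro order.trans[OF norm_sum] sum_mono order.trans[OF norm_sum])
         (simp add: norm_mult sign_def)
  qed simp
  have inf_minor: "(\<Sum>\<^sub>\<infinity>x\<in>{..<k} \<rightarrow>\<^sub>E S. kernel_minor K k x) =
      of_nat (fact k) * (\<Sum>J | J \<subseteq> {..<n} \<and> card J = k. principal_minor J M)" for k
  proof -
    have "((\<lambda>x. \<Sum>l\<in>{..<k} \<rightarrow>\<^sub>E {..<n}. \<Sum>\<sigma> | \<sigma> permutes {..<k}. of_int (sign \<sigma>) * T \<sigma> l x k)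
      has_sum (\<Sum>l\<in>{..<k} \<rightarrow>\<^sub>E {..<n}. \<Sum>\<sigma> | \<sigma> permutes {..<k}.
         of_int (sign \<sigma>) * (\<Prod>i<k. M (l i) (l (\<sigma> i))))) ({..<k} \<rightarrow>\<^sub>E S)"
    proof (intro has_sum_finite_sum has_sum_cmult_right)
      fix l \<sigma> assume "l \<in> {..<k} \<rightarrow>\<^sub>E {..<n}" "\<sigma> \<in> {\<sigma>. \<sigma> permutes {..<k}}"
      then show "((\<lambda>x. T \<sigma> l x k) has_sum (\<Prod>i<k. M (l i) (l (\<sigma> i)))) ({..<k} \<rightarrow>\<^sub>E S)"
        using smT' infT by (simp add: has_sum_iff)
    qed
    then have "(kernel_minor K k has_sum (\<Sum>l\<in>{..<k} \<rightarrow>\<^sub>E {..<n}. principal_minor {..<k} (\<lambda>i j. M (l i) (l j))))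
        ({..<k} \<rightarrow>\<^sub>E S)"
      unfolding principal_minor_def using expand by (simp cong: has_sum_cong)
    then show ?thesis by (simp add: sum_minors_eq_principal_minors infsumI)
  qed
  have minor_0: "kernel_minor K k x = 0" if "k > n" "x \<in> {..<k} \<rightarrow>\<^sub>E S" for k x
    unfolding minor[OF that(2)]
  proof (rule sum.neutral, rule ballI)
    fix l assume l: "l \<in> {..<k} \<rightarrow>\<^sub>E {..<n}"
    have "\<not> inj_on l {..<k}"
    proof
      assume "inj_on l {..<k}"
      moreover have "l ` {..<k} \<subseteq> {..<n}" using l by auto
      ultimately have "card {..<k} \<le> card {..<n}" by (intro card_inj_on_le) auto
      then show False using that(1) by simp
    qed
    then have "principal_minor {..<k} (\<lambda>i j. p (l i) (x j)) = 0"
      by (intro principal_minor_not_inj[of l k "{..<n}" "\<lambda>a j. p a (x j)"]) (use l in \<open>auto simp: PiE_iff\<close>)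
    then show "(\<Prod>i<k. g (l i) (x i)) * principal_minor {..<k} (\<lambda>i j. p (l i) (x j)) = 0"
      by simp
  qed
  have inf_0: "(\<Sum>\<^sub>\<infinity>x\<in>{..<k} \<rightarrow>\<^sub>E S. norm (kernel_minor K k x)) = 0"
    "(\<Sum>\<^sub>\<infinity>x\<in>{..<k} \<rightarrow>\<^sub>E S. kernel_minor K k x) = 0" if "k \<notin> {..n}" for k
  proof -
    have "n < k" using that by simp
    then show "(\<Sum>\<^sub>\<infinity>x\<in>{..<k} \<rightarrow>\<^sub>E S. norm (kernel_minor K k x)) = 0"
      "(\<Sum>\<^sub>\<infinity>x\<in>{..<k} \<rightarrow>\<^sub>E S. kernel_minor K k x) = 0"
      using minor_0 by (intro infsum_0; simp)+
  qed
  show "fredholm_convergent K S"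
    unfolding fredholm_convergent_def
  proof (intro conjI allI sm_minor)
    show "summable (\<lambda>k. (\<Sum>\<^sub>\<infinity>x\<in>{..<k} \<rightarrow>\<^sub>E S. norm (kernel_minor K k x)) / fact k)"
      by (rule summable_finite[of "{..n}"]) (simp_all add: inf_0)
  qed
  have "fredholm_det K S = (\<Sum>k\<le>n. (-1) ^ k / fact k * (\<Sum>\<^sub>\<infinity>x\<in>{..<k} \<rightarrow>\<^sub>E S. kernel_minor K k x))"
    unfolding fredholm_det_def
    by (rule suminf_finite) (simp_all add: inf_0)
  also have "\<dots> = (\<Sum>k\<le>n. \<Sum>J | J \<in> Pow {..<n} \<and> card J = k. (-1) ^ card J * principal_minor J M)"
    unfolding inf_minor by (intro sum.cong refl) (auto simp: sum_distrib_left)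
  also have "\<dots> = (\<Sum>J\<in>Pow {..<n}. (-1) ^ card J * principal_minor J M)"
  proof (rule sum.group)
    show "card ` Pow {..<n} \<subseteq> {..n}"
      using subset_eq_atLeast0_lessThan_card[of _ n] by (auto simp: atLeast0LessThan)
  qed simp_all
  finally show "fredholm_det K S =
       Determinant.det (mat n n (\<lambda>(i, j). (if i = j then 1 else 0) - (\<Sum>\<^sub>\<infinity>x\<in>S. p i x * g j x)))"
    by (simp add: det_one_minus_eq_sum_principal_minors M_def[abs_def])
qed

section \<open>Determinants summed over chains\<close>

lemma det_unitriangular_mult_left:
  fixes T U :: "nat \<Rightarrow> nat \<Rightarrow> 'c::comm_ring_1"
  assumes U: "\<And>j k. j < k \<Longrightarrow> k < n \<Longrightarrow> U j k = 0" "\<And>j. j < n \<Longrightarrow> U j j = 1"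
  shows "Determinant.det (mat n n (\<lambda>(j, i). \<Sum>k<n. U j k * T k i)) =
         Determinant.det (mat n n (\<lambda>(j, i). T j i))"
proof -
  let ?U = "mat n n (\<lambda>(j, k). U j k)" and ?T = "mat n n (\<lambda>(j, i). T j i)"
  have "mat n n (\<lambda>(j, i). \<Sum>k<n. U j k * T k i) = ?U * ?T"
    by (rule eq_matI) (auto simp: scalar_prod_def atLeast0LessThan)
  moreover have "Determinant.det ?U = prod_list (diag_mat ?U)"
    by (rule det_lower_triangular[where n = n]) (auto simp: U)
  moreover have "diag_mat ?U = replicate n 1"
    by (rule nth_equalityI) (auto simp: diag_mat_def U)
  ultimately show ?thesis
    by (simp add: det_mult[where n = n])
qed

lemma det_unitriangular_mult_right:
  fixes T U :: "nat \<Rightarrow> nat \<Rightarrow> 'c::comm_ring_1"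
  assumes U: "\<And>j k. j < k \<Longrightarrow> k < n \<Longrightarrow> U j k = 0" "\<And>j. j < n \<Longrightarrow> U j j = 1"
  shows "Determinant.det (mat n n (\<lambda>(j, i). \<Sum>k<n. U i k * T j k)) =
         Determinant.det (mat n n (\<lambda>(j, i). T j i))"
proof -
  have tr: "Determinant.det (mat n n (\<lambda>(j, i). A j i)) = Determinant.det (mat n n (\<lambda>(j, i). A i j))"
    for A :: "nat \<Rightarrow> nat \<Rightarrow> 'c"
  proof -
    have "transpose_mat (mat n n (\<lambda>(j, i). A j i)) = mat n n (\<lambda>(j, i). A i j)"
      by (rule eq_matI) auto
    then show ?thesis by (metis det_transpose mat_carrier)
  qed
  show ?thesis
    using det_unitriangular_mult_left[of n U "\<lambda>k i. T i k"] U
    by (subst (1 2) tr) simp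
qed

text \<open>
  The determinant is a linear functional of one row when the others are fixed; its coefficients are
  the cofactors, which do not see that row.
\<close>

lemma det_row_functional:
  fixes c :: "nat \<Rightarrow> nat \<Rightarrow> 'c::comm_ring_1"
  assumes k: "k < n"
  obtains \<gamma> where
    "\<And>u. Determinant.det (mat n n (\<lambda>(j, i). if j = k then u i else c j i)) = (\<Sum>i<n. \<gamma> i * u i)"
proof -
  define A where "A u = mat n n (\<lambda>(j, i). if j = k then u i else c j i)" for u
  have "Determinant.det (A u) = (\<Sum>i<n. cofactor (A (\<lambda>_. 0)) k i * u i)" for u
  proof -
    have "mat_delete (A u) k i = mat_delete (A (\<lambda>_. 0)) k i" for i
      by (rule eq_matI) (auto simp: mat_delete_def A_def)
    then have "cofactor (A u) k i = cofactor (A (\<lambda>_. 0)) k i" for i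
      by (simp add: cofactor_def)
    then show ?thesis
      using laplace_expansion_row[of "A u" n k] k by (simp add: A_def mult.commute)
  qed
  then show ?thesis using that unfolding A_def by blast
qed

text \<open>
  A vector \<open>x\<^sub>1 \<le> \<dots> \<le> x\<^sub>k\<close> is encoded as a function with \<open>x\<^sub>0 = 0\<close> and zeros beyond \<open>k\<close>: the boundary
  value \<open>x\<^sub>0\<close> treats the first coordinate like the others, and the zeros make the encoding unique.
\<close>

definition chains :: "nat \<Rightarrow> (nat \<Rightarrow> nat) \<Rightarrow> (nat \<Rightarrow> nat) set" where
  "chains k y = {x. x 0 = 0 \<and> (\<forall>j<k. x j \<le> x (Suc j)) \<and> (\<forall>j\<le>k. x j \<le> y j) \<and> (\<forall>j>k. x j = 0)}"

lemma chains_0: "chains 0 y = {\<lambda>_. 0}"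
  by (auto simp: chains_def fun_eq_iff) (metis gr0I)

lemma chains_eq_0: "x \<in> chains k y \<Longrightarrow> k < j \<Longrightarrow> x j = 0"
  by (simp add: chains_def)

lemma chainsD:
  assumes "x \<in> chains k y"
  shows "x 0 = 0" and "j < k \<Longrightarrow> x j \<le> x (Suc j)" and "j \<le> k \<Longrightarrow> x j \<le> y j"
  using assms by (simp_all add: chains_def)

lemma finite_chains: "finite (chains k y)"
proof (rule finite_subset)
  show "chains k y \<subseteq> {x. \<forall>j. (j \<in> {..k} \<longrightarrow> x j \<in> {..Max (y ` {..k})}) \<and> (j \<notin> {..k} \<longrightarrow> x j = 0)}"
    by (auto simp: chains_def intro: order.trans Max_ge)
  show "finite {x :: nat \<Rightarrow> nat. \<forall>j. (j \<in> {..k} \<longrightarrow> x j \<in> {..Max (y ` {..k})}) \<and> (j \<notin> {..k} \<longrightarrow> x j = 0)}"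
    by (rule finite_set_of_finite_funs) auto
qed

lemma sum_chains_Suc:
  "(\<Sum>x\<in>chains (Suc k) y. F x) = (\<Sum>x\<in>chains k y. \<Sum>t\<in>{x k..y (Suc k)}. F (x(Suc k := t)))"
proof -
  have "(\<Sum>x\<in>chains k y. \<Sum>t\<in>{x k..y (Suc k)}. F (x(Suc k := t))) =
        (\<Sum>(x, t)\<in>Sigma (chains k y) (\<lambda>x. {x k..y (Suc k)}). F (x(Suc k := t)))"
    by (rule sum.Sigma) (auto simp: finite_chains)
  also have "\<dots> = (\<Sum>x\<in>chains (Suc k) y. F x)"
    by (rule sum.reindex_bij_witness[of _ "\<lambda>x. (x(Suc k := 0), x (Suc k))" "\<lambda>(x, t). x(Suc k := t)"])
       (auto simp: chains_def le_Suc_eq less_Suc_eq)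
  finally show ?thesis by simp
qed

text \<open>
  Coordinates are summed out from the last to the first. After the summation over \<open>x\<^sub>j\<^sub>+\<^sub>1\<close>, starting at
  \<open>a = x\<^sub>j\<close>, row \<open>j\<close> (which belongs to \<open>x\<^sub>j\<^sub>+\<^sub>1\<close>) consists of \<open>S j\<close> and the boundary term \<open>- \<kappa> j * e j i (x j)\<close>. The
  latter is a multiple of the row above it, or zero for the first row, and drops out.
  Hence the ordering of the chain leaves no trace in the result.
\<close>

lemma sum_chains_det:
  fixes e :: "nat \<Rightarrow> nat \<Rightarrow> nat \<Rightarrow> 'c::comm_ring_1"
  assumes step: "\<And>i j a. j < n \<Longrightarrow> i < n \<Longrightarrow> a \<le> y j \<Longrightarrow>
      (\<Sum>t\<in>{a..y (Suc j)}. h j t * e (Suc j) i t) = S j i - \<kappa> j * e j i a"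
    and e0: "\<And>i. i < n \<Longrightarrow> e 0 i 0 = 0"
  shows "(\<Sum>x\<in>chains n y. Determinant.det (mat n n (\<lambda>(j, i). e (Suc j) i (x (Suc j)))) *
            (\<Prod>j<n. h j (x (Suc j)))) = Determinant.det (mat n n (\<lambda>(j, i). S j i))"
proof -
  define D where "D k x = Determinant.det (mat n n (\<lambda>(j, i). if j < k then e (Suc j) i (x (Suc j)) else S j i))"
    for k and x :: "nat \<Rightarrow> nat"
  have "(\<Sum>x\<in>chains k y. D k x * (\<Prod>j<k. h j (x (Suc j)))) = Determinant.det (mat n n (\<lambda>(j, i). S j i))"
    if "k \<le> n" for k
    using that
  proof (induction k)
    case 0
    then show ?case by (simp add: chains_0 D_def)
  next
    case (Suc k)
    then have k: "k < n" by simp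
    have row: "(\<Sum>t\<in>{x k..y (Suc k)}. h k t * D (Suc k) (x(Suc k := t))) = D k x"
      if x: "x \<in> chains k y" for x
    proof -
      let ?c = "\<lambda>j i. if j < k then e (Suc j) i (x (Suc j)) else S j i"
      obtain \<gamma> where \<gamma>: "\<And>u. Determinant.det (mat n n (\<lambda>(j, i). if j = k then u i else ?c j i)) = (\<Sum>i<n. \<gamma> i * u i)"
        using det_row_functional[OF k, of ?c] by auto
      have D1: "D (Suc k) (x(Suc k := t)) = (\<Sum>i<n. \<gamma> i * e (Suc k) i t)" for t
        unfolding D_def \<gamma>[symmetric]
        by (intro arg_cong[of _ _ Determinant.det] eq_matI) (auto simp: less_Suc_eq)
      have D0: "D k x = (\<Sum>i<n. \<gamma> i * S k i)"
        unfolding D_def \<gamma>[symmetric]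
        by (intro arg_cong[of _ _ Determinant.det] eq_matI) auto
      (* The boundary terms form the row of index k - 1, or a zero row if k = 0. *)
      have Z: "(\<Sum>i<n. \<gamma> i * e k i (x k)) = 0"
      proof (cases k)
        case 0
        then show ?thesis using x e0 by (simp add: chains_def)
      next
        case (Suc k')
        have "Determinant.det (mat n n (\<lambda>(j, i). if j = k then e k i (x k) else ?c j i)) = 0"
          by (rule det_identical_rows[where n = n and i = k' and j = k])
             (use Suc k in \<open>auto intro!: eq_vecI\<close>)
        then show ?thesis unfolding \<gamma> .
      qed
      have "(\<Sum>t\<in>{x k..y (Suc k)}. h k t * D (Suc k) (x(Suc k := t))) =
         (\<Sum>i<n. \<gamma> i * (\<Sum>t\<in>{x k..y (Suc k)}. h k t * e (Suc k) i t))"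
        unfolding D1 sum_distrib_left by (subst sum.swap) (simp add: ac_simps)
      also have "\<dots> = (\<Sum>i<n. \<gamma> i * (S k i - \<kappa> k * e k i (x k)))"
        using step[OF k] x by (intro sum.cong refl) (auto simp: chains_def)
      also have "\<dots> = (\<Sum>i<n. \<gamma> i * S k i) - \<kappa> k * (\<Sum>i<n. \<gamma> i * e k i (x k))"
        by (simp add: algebra_simps sum_subtractf sum_distrib_left)
      finally show ?thesis using Z D0 by simp
    qed
    have "(\<Sum>x\<in>chains (Suc k) y. D (Suc k) x * (\<Prod>j<Suc k. h j (x (Suc j)))) =
          (\<Sum>x\<in>chains k y. (\<Sum>t\<in>{x k..y (Suc k)}. h k t * D (Suc k) (x(Suc k := t))) *
             (\<Prod>j<k. h j (x (Suc j))))"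
      unfolding sum_chains_Suc sum_distrib_right by (intro sum.cong refl) (auto simp: ac_simps)
    also have "\<dots> = (\<Sum>x\<in>chains k y. D k x * (\<Prod>j<k. h j (x (Suc j))))"
      by (intro sum.cong refl) (simp add: row)
    finally show ?case using Suc by simp
  qed
  from this[of n] have "(\<Sum>x\<in>chains n y. D n x * (\<Prod>j<n. h j (x (Suc j)))) =
      Determinant.det (mat n n (\<lambda>(j, i). S j i))" by simp
  moreover have "D n x = Determinant.det (mat n n (\<lambda>(j, i). e (Suc j) i (x (Suc j))))" for x
    unfolding D_def by (intro arg_cong[of _ _ Determinant.det] eq_matI) auto
  ultimately show ?thesis by simp
qed

text \<open>
  The summation needed for one step of the column process: \<open>H\<close> is the convolution of \<open>g\<close> with the
  geometric distribution, expressed by its recurrence, and \<open>Y\<close> is the value of the neighbour that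
  has already been updated. For \<open>x \<le> Y\<close> the weight is constant and the sum telescopes; this is the base
  case, and each increment of \<open>y\<close> multiplies both sides by \<open>q\<close> and adds the same term.
\<close>

lemma geometric_step_sum:
  fixes q :: "'c::comm_ring_1"
  assumes H: "\<And>x. H (Suc x) - q * H x = (1 - q) * g (Suc x)"
    and "a \<le> Y" "Y \<le> y"
  shows "(\<Sum>x\<in>{a..y}. ((1 - q) * q ^ (y - max x Y)) * (g (Suc x) - g x)) =
     (H (Suc y) - H y) + (1 - q) * q ^ (y - Y) * H Y - (1 - q) * q ^ (y - Y) * g a"
  using \<open>Y \<le> y\<close>
proof (induction y rule: dec_induct)
  case base
  have "(\<Sum>x\<in>{a..Y}. ((1 - q) * q ^ (Y - max x Y)) * (g (Suc x) - g x)) =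
      (1 - q) * (\<Sum>x\<in>{a..Y}. g (Suc x) - g x)"
    unfolding sum_distrib_left by (intro sum.cong refl) (auto simp: max_def)
  also have "(\<Sum>x\<in>{a..Y}. g (Suc x) - g x) = g (Suc Y) - g a"
    using \<open>a \<le> Y\<close> by (intro sum_Suc_diff) simp
  finally have eq: "(\<Sum>x\<in>{a..Y}. ((1 - q) * q ^ (Y - max x Y)) * (g (Suc x) - g x)) =
      (1 - q) * (g (Suc Y) - g a)" .
  show ?case unfolding eq using H[of Y] by (simp add: algebra_simps)
next
  case (step y)
  have "(\<Sum>x\<in>{a..Suc y}. ((1 - q) * q ^ (Suc y - max x Y)) * (g (Suc x) - g x)) =
     (\<Sum>x\<in>{a..y}. ((1 - q) * q ^ (Suc y - max x Y)) * (g (Suc x) - g x)) +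
       (1 - q) * (g (Suc (Suc y)) - g (Suc y))"
    using step \<open>a \<le> Y\<close> by (subst sum.cl_ivl_Suc) (auto simp: max_def)
  also have "(\<Sum>x\<in>{a..y}. ((1 - q) * q ^ (Suc y - max x Y)) * (g (Suc x) - g x)) =
     q * (\<Sum>x\<in>{a..y}. ((1 - q) * q ^ (y - max x Y)) * (g (Suc x) - g x))"
    unfolding sum_distrib_left using step(1)
    by (intro sum.cong refl) (simp add: Suc_diff_le ac_simps)
  finally have eq: "(\<Sum>x\<in>{a..Suc y}. ((1 - q) * q ^ (Suc y - max x Y)) * (g (Suc x) - g x)) =
      q * ((H (Suc y) - H y) + (1 - q) * q ^ (y - Y) * H Y - (1 - q) * q ^ (y - Y) * g a) +
      (1 - q) * (g (Suc (Suc y)) - g (Suc y))"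
    unfolding step.IH .
  show ?case
    unfolding eq using step(1) H[of y] H[of "Suc y"] by (simp add: Suc_diff_le algebra_simps)
qed

text \<open>
  The rows \<open>t (Suc j)\<close> are recovered by a bidiagonal unitriangular row operation.
\<close>

lemma det_add_previous_rows:
  fixes t :: "nat \<Rightarrow> nat \<Rightarrow> 'c::comm_ring_1"
  assumes "\<And>i. i < n \<Longrightarrow> t 0 i = 0"
  shows "Determinant.det (mat n n (\<lambda>(j, i). t (Suc j) i + c j * t j i)) =
         Determinant.det (mat n n (\<lambda>(j, i). t (Suc j) i))"
proof -
  define U where "U j k = (if k = j then 1 else if Suc k = j then c j else 0)" for j k
  have "(\<Sum>k<n. U j k * t (Suc k) i) = t (Suc j) i + c j * t j i" if "j < n" "i < n" for j i
  proof -
    have "(\<Sum>k<n. U j k * t (Suc k) i) = (\<Sum>k<n. (if k = j then t (Suc k) i else 0) + (if Suc k = j then c j * t (Suc k) i else 0))"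
      by (intro sum.cong refl) (auto simp: U_def)
    also have "\<dots> = t (Suc j) i + (\<Sum>k<n. if Suc k = j then c j * t (Suc k) i else 0)"
      using that by (simp add: sum.distrib)
    also have "(\<Sum>k<n. if Suc k = j then c j * t (Suc k) i else 0) = c j * t j i"
      using that assms by (cases j) auto
    finally show ?thesis .
  qed
  then have "mat n n (\<lambda>(j, i). t (Suc j) i + c j * t j i) = mat n n (\<lambda>(j, i). \<Sum>k<n. U j k * t (Suc k) i)"
    by (intro eq_matI) auto
  then show ?thesis
    using det_unitriangular_mult_left[of n U "\<lambda>k i. t (Suc k) i"] by (simp add: U_def)
qed

section \<open>The recursion for last-passage times\<close>

text \<open>
  The recursion of the last-passage times with boundary value \<open>0\<close>, which makes the columns a
  Markov chain driven by the columns of weights.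
\<close>

fun lpp :: "(nat \<Rightarrow> nat \<Rightarrow> nat) \<Rightarrow> nat \<Rightarrow> nat \<Rightarrow> nat" where
  "lpp w 0 n = 0"
| "lpp w (Suc m) 0 = 0"
| "lpp w (Suc m) (Suc n) = max (lpp w m (Suc n)) (lpp w (Suc m) n) + w (Suc m) (Suc n)"

lemma lpp_0_right [simp]: "lpp w m 0 = 0"
  by (cases m) auto

lemma lpp_mono: "lpp w m n \<le> lpp w m (Suc n)"
  by (cases m) auto

lemma lpp_mono_le: "j \<le> n \<Longrightarrow> lpp w m j \<le> lpp w m n"
  by (rule lift_Suc_mono_le[where f = "lpp w m", OF lpp_mono])

lemma lpp_mono': "lpp w m n \<le> lpp w (Suc m) n"
  by (cases n) auto

lemma lpp_cong:
  assumes "\<And>i j. i \<in> {1..m} \<Longrightarrow> j \<in> {1..n} \<Longrightarrow> a i j = b i j"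
  shows "lpp a m n = lpp b m n"
  using assms by (induction a m n rule: lpp.induct) auto

text \<open>
  The last step of a path; the new endpoint is fresh, so sums over the visited set split off its weight.
\<close>

lemma up_right_paths_cases:
  assumes "p \<in> up_right_paths m n"
  obtains (single) "p = [(1, 1)]" "m = 1" "n = 1"
  | (snoc) p' i j where "p = p' @ [(m, n)]" "p' \<in> up_right_paths i j" "(m, n) \<notin> set p'"
      "1 \<le> i" "1 \<le> j" "(m, n) = (i + 1, j) \<or> (m, n) = (i, j + 1)"
proof (cases p rule: rev_cases)
  case Nil
  then show ?thesis using assms by (simp add: up_right_paths_def)
next
  case (snoc p' a)
  then have a: "a = (m, n)" using assms by (simp add: up_right_paths_def)
  show ?thesis
  proof (cases "p' = []")
    case True
    then show ?thesis using snoc assms by (intro single) (auto simp: up_right_paths_def)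
  next
    case False
    obtain i j where ij: "last p' = (i, j)" by (cases "last p'")
    have p': "p' \<in> up_right_paths i j"
      and st: "(m, n) = (i + 1, j) \<or> (m, n) = (i, j + 1)"
      using assms False ij snoc a by (auto simp: up_right_paths_def successively_append_iff)
    have sub: "set p' \<subseteq> {1..i} \<times> {1..j}"
      using up_right_paths_bounds[OF p'] by auto
    moreover have "(i, j) \<in> set p'" using False ij by (metis last_in_set)
    ultimately have "1 \<le> i" "1 \<le> j" by auto
    moreover have "(m, n) \<notin> set p'" using sub st by auto
    ultimately show ?thesis using p' st snoc a that(2) by blast
  qed
qed

lemma path_sum_le_lpp:
  "p \<in> up_right_paths m n \<Longrightarrow> (\<Sum>(i, j)\<in>set p. w i j) \<le> lpp w m n"
proof (induction p arbitrary: m n rule: length_induct)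
  case (1 p)
  from 1(2) show ?case
  proof (cases rule: up_right_paths_cases)
    case single
    then show ?thesis by simp
  next
    case (snoc p' i j)
    have IH: "(\<Sum>(i, j)\<in>set p'. w i j) \<le> lpp w i j"
      using 1(1) snoc by auto
    have sum: "(\<Sum>(i, j)\<in>set p. w i j) = w m n + (\<Sum>(i, j)\<in>set p'. w i j)"
      using snoc(1,3) by simp
    obtain m' n' where mn: "m = Suc m'" "n = Suc n'"
      using snoc(4-6) by (cases m; cases n) auto
    have "lpp w i j \<le> max (lpp w m' (Suc n')) (lpp w (Suc m') n')"
      using snoc(6) mn by auto
    then show ?thesis unfolding sum using IH mn by simp
  qed
qed

lemma lpp_attained:
  "1 \<le> m \<Longrightarrow> 1 \<le> n \<Longrightarrow> \<exists>p\<in>up_right_paths m n. (\<Sum>(i, j)\<in>set p. w i j) = lpp w m n"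
proof (induction w m n rule: lpp.induct)
  case (3 w m n)
  have ext: ?case if p: "p \<in> up_right_paths i j" and "(\<Sum>(i, j)\<in>set p. w i j) = lpp w i j"
    and st: "(Suc m, Suc n) = (i + 1, j) \<or> (Suc m, Suc n) = (i, j + 1)"
    and ge: "max (lpp w m (Suc n)) (lpp w (Suc m) n) = lpp w i j" for p i j
  proof (rule bexI)
    have "(Suc m, Suc n) \<notin> set p"
      using up_right_paths_bounds[OF p] st by auto
    then show "(\<Sum>(i, j)\<in>set (p @ [(Suc m, Suc n)]). w i j) = lpp w (Suc m) (Suc n)"
      using that by simp
    show "p @ [(Suc m, Suc n)] \<in> up_right_paths (Suc m) (Suc n)"
      by (rule up_right_paths_snoc[OF p st])
  qed
  consider "m = 0" "n = 0" | "m \<ge> 1" "lpp w (Suc m) n \<le> lpp w m (Suc n)"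
    | "n \<ge> 1" "lpp w m (Suc n) \<le> lpp w (Suc m) n"
  proof (cases m; cases n)
    fix n' assume "m = 0" "n = Suc n'" then show ?thesis using that(3) by simp
  next
    fix m' assume "m = Suc m'" "n = 0" then show ?thesis using that(2) by simp
  next
    fix m' n' assume "m = Suc m'" "n = Suc n'" then show ?thesis using that(2,3) by linarith
  qed (use that in auto)
  then show ?case
  proof cases
    case 1
    have "[(1, 1)] \<in> up_right_paths 1 1" by (simp add: up_right_paths_def)
    then show ?thesis using 1 by (intro bexI[of _ "[(1, 1)]"]) auto
  next
    case 2
    then obtain p where "p \<in> up_right_paths m (Suc n)" "(\<Sum>(i, j)\<in>set p. w i j) = lpp w m (Suc n)"
      using "3.IH"(1) by auto
    then show ?thesis using 2 by (intro ext) auto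
  next
    case 3
    then obtain p where "p \<in> up_right_paths (Suc m) n" "(\<Sum>(i, j)\<in>set p. w i j) = lpp w (Suc m) n"
      using "3.IH"(2) by auto
    then show ?thesis using 3 by (intro ext) auto
  qed
qed auto

lemma last_passage_eq_lpp:
  assumes "1 \<le> m" "1 \<le> n"
  shows "last_passage w m n = lpp w m n"
  unfolding last_passage_def
proof (rule Max_eqI)
  show "finite ((\<lambda>p. \<Sum>(i, j)\<in>set p. w i j) ` up_right_paths m n)"
    by (intro finite_imageI finite_up_right_paths)
  show "lpp w m n \<in> (\<lambda>p. \<Sum>(i, j)\<in>set p. w i j) ` up_right_paths m n"
    using lpp_attained[OF assms, of w] by force
qed (auto intro: path_sum_le_lpp)

section \<open>Differences of negative binomial laws\<close>

text \<open>
  Multiplication by \<open>X\<^sup>-\<^sup>1 - 1\<close> is the forward difference on coefficient sequences. Being a unit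
  in the field of Laurent series, it also has negative powers, which are iterated summations.
\<close>

definition fls_diff :: "'a::field fls" where
  "fls_diff = fls_X_inv - 1"

text \<open>
  The generating function of \<open>q\<^sup>x\<close>; multiplying by it is convolution with a geometric sequence.
\<close>

definition fls_geo :: "'a::field \<Rightarrow> 'a fls" where
  "fls_geo q = inverse (1 - fls_const q * fls_X)"

lemma fls_diff_mult_nth: "fls_nth (fls_diff * f) x = fls_nth f (x + 1) - fls_nth f x"
  by (simp add: fls_diff_def left_diff_distrib fls_X_inv_times_conv_shift)

lemma fls_diff_subdegree [simp]: "fls_subdegree fls_diff = -1"
  by (rule fls_subdegree_eqI) (auto simp: fls_diff_def)

lemma fls_diff_nonzero [simp]: "fls_diff \<noteq> 0"
  using fls_diff_subdegree by (metis fls_zero_subdegree zero_neq_neg_one)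

lemma one_minus_qX_nth:
  "fls_nth (1 - fls_const q * fls_X) k = (if k = 0 then 1 else if k = 1 then - q else (0::'a::field))"
  by (auto simp: fls_X_times_conv_shift)

lemma one_minus_qX_subdegree: "fls_subdegree (1 - fls_const q * fls_X :: 'a::field fls) = 0"
  by (rule fls_subdegree_eqI) (simp_all only: one_minus_qX_nth, auto)

lemma one_minus_qX_nonzero: "1 - fls_const q * fls_X \<noteq> (0 :: 'a::field fls)"
  using one_minus_qX_nth[of q 0] by (metis fls_zero_nth zero_neq_one)

lemma fls_geo_mult_nth: "fls_nth (fls_geo q * f) x - q * fls_nth (fls_geo q * f) (x - 1) = fls_nth f x"
proof -
  have "(1 - fls_const q * fls_X) * (fls_geo q * f) = f"
    using one_minus_qX_nonzero[of q] by (simp add: fls_geo_def)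
  then have "fls_nth f x = fls_nth ((1 - fls_const q * fls_X) * (fls_geo q * f)) x" by (simp only:)
  also have "\<dots> = fls_nth (fls_geo q * f) x - q * fls_nth (fls_geo q * f) (x - 1)"
    by (simp only: left_diff_distrib mult.assoc fls_minus_nth mult_1 fls_mult_const_nth)
       (simp add: fls_X_times_conv_shift)
  finally show ?thesis by simp
qed

lemma fls_geo_subdegree [simp]: "fls_subdegree (fls_geo q) = 0"
  by (simp add: fls_geo_def one_minus_qX_subdegree)

lemma fls_geo_nonzero [simp]: "fls_geo q \<noteq> 0"
  using one_minus_qX_nonzero by (simp add: fls_geo_def)

lemma fls_diff_powi_subdegree [simp]: "fls_subdegree (fls_diff powi d :: 'a::field fls) = - d"
  by (cases d rule: int_cases2)
     (simp_all add: power_int_minus fls_subdegree_pow)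

lemma fls_diff_powi_geo_nth_eq_0:
  "x < - d \<Longrightarrow> fls_nth (fls_diff powi d * fls_geo q ^ m) x = 0"
  by (intro fls_eq0_below_subdegree) (simp add: fls_subdegree_pow)

lemma fls_diff_power_nth_pos: "0 < x \<Longrightarrow> fls_nth (fls_diff ^ k :: 'a::field fls) x = 0"
  by (induction k arbitrary: x) (auto simp: fls_diff_mult_nth)

text \<open>
  The value at \<open>x\<close> of the \<open>d\<close>-th difference of the law of a sum of \<open>m\<close> independent geometric
  variables; for \<open>d < 0\<close> the difference is a repeated partial sum.
\<close>

definition neg_binomial_diff :: "'a::field \<Rightarrow> nat \<Rightarrow> int \<Rightarrow> int \<Rightarrow> 'a" where
  "neg_binomial_diff q m d x = (1 - q) ^ m * fls_nth (fls_diff powi d * fls_geo q ^ m) x"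

text \<open>
  With \<open>neg_binomial_diff_Suc\<close> and \<open>neg_binomial_diff_eq_0\<close>, this is everything that the induction
  over the columns uses about these numbers, apart from their values for \<open>m = 0\<close>.
\<close>

lemma neg_binomial_diff_diff:
  fixes d :: int
  shows
  "neg_binomial_diff q m (d + 1) x = neg_binomial_diff q m d (x + 1) - neg_binomial_diff q m d x"
proof -
  have "fls_diff powi (d + 1) * fls_geo q ^ m = fls_diff * (fls_diff powi d * fls_geo q ^ m)"
    by (simp add: power_int_add mult_ac)
  then show ?thesis
    by (simp only: neg_binomial_diff_def fls_diff_mult_nth right_diff_distrib)
qed

lemma neg_binomial_diff_Suc:
  "neg_binomial_diff q (Suc m) d (x + 1) - q * neg_binomial_diff q (Suc m) d x =
    (1 - q) * neg_binomial_diff q m d (x + 1)"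
proof -
  have "fls_diff powi d * fls_geo q ^ Suc m = fls_geo q * (fls_diff powi d * fls_geo q ^ m)"
    by (simp add: mult_ac)
  then have "neg_binomial_diff q (Suc m) d (x + 1) - q * neg_binomial_diff q (Suc m) d x =
      (1 - q) ^ Suc m * (fls_nth (fls_geo q * (fls_diff powi d * fls_geo q ^ m)) (x + 1) -
        q * fls_nth (fls_geo q * (fls_diff powi d * fls_geo q ^ m)) x)"
    by (simp only: neg_binomial_diff_def) (simp only: right_diff_distrib mult_ac)
  also have "\<dots> = (1 - q) ^ Suc m * fls_nth (fls_diff powi d * fls_geo q ^ m) (x + 1)"
    using fls_geo_mult_nth[of q "fls_diff powi d * fls_geo q ^ m" "x + 1"] by simp
  finally show ?thesis by (simp add: neg_binomial_diff_def)
qed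

lemma neg_binomial_diff_eq_0: "x < - d \<Longrightarrow> neg_binomial_diff q m d x = 0"
  by (simp add: neg_binomial_diff_def fls_diff_powi_geo_nth_eq_0)


section \<open>The distribution of last-passage times as a determinant\<close>

context prob_space
begin

text \<open>
  For \<open>m = 0\<close> the column is identically zero. The matrix is triangular with ones on the diagonal at \<open>x = 0\<close>, and its last row,
  made of coefficients of nonnegative powers of \<open>X\<^sup>-\<^sup>1 - 1\<close>, vanishes when \<open>x\<^sub>n > 0\<close>.
  In the step, the new column is independent of the earlier ones, so the law of the next column
  is a sum over the chains \<open>y \<le> x\<close> of previous values. That sum is evaluated by \<open>sum_chains_det\<close> and
  \<open>geometric_step_sum\<close>, up to multiples of the preceding rows.
\<close>

lemma lpp_column_density:
  fixes w :: "nat \<Rightarrow> nat \<Rightarrow> 'a \<Rightarrow> nat" and q :: real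
  assumes indep: "indep_vars (\<lambda>_. count_space UNIV) (\<lambda>(i, j). w i j) ({1..} \<times> {1..})"
    and geo: "\<And>i j k. 1 \<le> i \<Longrightarrow> 1 \<le> j \<Longrightarrow> prob {\<omega> \<in> space M. w i j \<omega> = k} = (1 - q) * q ^ k"
    and n: "1 \<le> n"
  shows "x 0 = 0 \<Longrightarrow> (\<And>j. j < n \<Longrightarrow> x j \<le> x (Suc j)) \<Longrightarrow>
    {\<omega> \<in> space M. \<forall>j\<le>n. lpp (\<lambda>i j. w i j \<omega>) m j = x j} \<in> events \<and>
    complex_of_real (prob {\<omega> \<in> space M. \<forall>j\<le>n. lpp (\<lambda>i j. w i j \<omega>) m j = x j}) =
    Determinant.det (mat n n (\<lambda>(j, i).
      neg_binomial_diff (complex_of_real q) m (int j - int i) (int (x (Suc j)))))"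
proof (induction m arbitrary: x)
  case 0
  let ?A = "mat n n (\<lambda>(j, i). neg_binomial_diff (complex_of_real q) 0 (int j - int i) (int (x (Suc j))))"
  have entry: "neg_binomial_diff (complex_of_real q) 0 (int j - int i) y = fls_nth (fls_diff ^ (j - i)) y"
    if "i \<le> j" for i j y
    using that by (simp add: neg_binomial_diff_def of_nat_diff[symmetric] del: of_nat_diff)
  have le: "x j \<le> x n" if "j \<le> n" for j
    using that 0(2) by (induction rule: inc_induct) (auto intro: order.trans)
  show ?case
  proof (cases "x n = 0")
    case True
    then have x0: "x j = 0" if "j \<le> n" for j using le[OF that] by simp
    have "Determinant.det ?A = prod_list (diag_mat ?A)"
      by (rule det_lower_triangular[where n = n]) (auto simp: x0 intro: neg_binomial_diff_eq_0)
    also have "diag_mat ?A = replicate n 1"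
      by (rule nth_equalityI) (auto simp: diag_mat_def x0 neg_binomial_diff_def)
    finally have det: "Determinant.det ?A = 1" by simp
    have full: "{\<omega> \<in> space M. \<forall>j\<le>n. lpp (\<lambda>i j. w i j \<omega>) 0 j = x j} = space M"
      by (auto simp: x0)
    show ?thesis unfolding full using det by (simp add: prob_space)
  next
    case False
    have "Determinant.det ?A = (\<Sum>i<n. ?A $$ (n - 1, i) * cofactor ?A (n - 1) i)"
      by (rule laplace_expansion_row) (use n in auto)
    also have "\<dots> = 0"
    proof (rule sum.neutral, rule ballI)
      fix i assume "i \<in> {..<n}"
      then have "neg_binomial_diff (complex_of_real q) 0 (int (n - 1) - int i) (int (x n)) = 0"
        using False by (subst entry) (auto intro: fls_diff_power_nth_pos)
      then show "?A $$ (n - 1, i) * cofactor ?A (n - 1) i = 0"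
        using n \<open>i \<in> {..<n}\<close> by (simp del: of_nat_diff)
    qed
    finally have det: "Determinant.det ?A = 0" .
    have empty: "{\<omega> \<in> space M. \<forall>j\<le>n. lpp (\<lambda>i j. w i j \<omega>) 0 j = x j} = {}"
      using False by (auto intro!: exI[of _ n])
    show ?thesis unfolding empty using det by simp
  qed
next
  case (Suc m)
  let ?Q = "complex_of_real q"
  let ?L = "\<lambda>x m. {\<omega> \<in> space M. \<forall>j\<le>n. lpp (\<lambda>i j. w i j \<omega>) m j = x j}"
  have idx: "int (Suc j) - int i - 1 = int j - int i" for i j by simp
  let ?W = "\<lambda>b. {\<omega> \<in> space M. \<forall>j<n. w (Suc m) (Suc j) \<omega> = b j}"
  (* The weights that carry the column y to the column x. *)
  define b where "b y j = x (Suc j) - max (y (Suc j)) (x j)" for y j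
  (* The values of column m and the weights of column Suc m determine column Suc m. *)
  have dec: "?L x (Suc m) = (\<Union>y\<in>chains n x. ?L y m \<inter> ?W (b y))"
  proof (intro equalityI subsetI)
    fix \<omega> assume \<omega>: "\<omega> \<in> ?L x (Suc m)"
    define y where "y j = (if j \<le> n then lpp (\<lambda>i j. w i j \<omega>) m j else 0)" for j
    have L: "lpp (\<lambda>i j. w i j \<omega>) (Suc m) j = x j" if "j \<le> n" for j
      using \<omega> that by blast
    have "y j \<le> x j" if "j \<le> n" for j
      using L[OF that] that lpp_mono'[of "\<lambda>i j. w i j \<omega>" m j] by (simp add: y_def)
    then have "y \<in> chains n x"
      using lpp_mono by (simp add: chains_def) (simp add: y_def)
    moreover have "w (Suc m) (Suc j) \<omega> = b y j" if "j < n" for j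
      using L[of "Suc j"] L[of j] that by (simp add: b_def y_def)
    ultimately show "\<omega> \<in> (\<Union>y\<in>chains n x. ?L y m \<inter> ?W (b y))"
      using \<omega> by (intro UN_I[of y]) (auto simp: y_def)
  next
    fix \<omega> assume "\<omega> \<in> (\<Union>y\<in>chains n x. ?L y m \<inter> ?W (b y))"
    then obtain y where y: "y \<in> chains n x" and \<omega>: "\<omega> \<in> space M"
      and L: "\<And>j. j \<le> n \<Longrightarrow> lpp (\<lambda>i j. w i j \<omega>) m j = y j"
      and W: "\<And>j. j < n \<Longrightarrow> w (Suc m) (Suc j) \<omega> = b y j" by auto
    have "lpp (\<lambda>i j. w i j \<omega>) (Suc m) j = x j" if "j \<le> n" for j
      using that
    proof (induction j)
      case 0
      then show ?case using Suc.prems(1) by simp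
    next
      case (Suc j)
      have "y (Suc j) \<le> x (Suc j)" "x j \<le> x (Suc j)"
        using y Suc.prems \<open>\<And>j. j < n \<Longrightarrow> x j \<le> x (Suc j)\<close> by (auto simp: chains_def)
      then show ?case using Suc L[of "Suc j"] W[of j] by (simp add: b_def)
    qed
    then show "\<omega> \<in> ?L x (Suc m)" using \<omega> by simp
  qed
  (* Independence of the past A and the next column of weights B. *)
  define A where "A = {1..m} \<times> {1..n}"
  define B where "B = {Suc m} \<times> {1..n}"
  define X where "X = (\<lambda>(i, j). w i j)"
  define N where "N = (\<lambda>_ :: nat \<times> nat. count_space (UNIV :: nat set))"
  have ind: "indep_vars N X ({1..} \<times> {1..})" using indep by (simp add: X_def N_def)
  have B_eq: "B = (\<lambda>j. (Suc m, Suc j)) ` {..<n}"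
    unfolding B_def image_Suc_lessThan[symmetric] by auto
  have fin: "finite A" "finite B" by (auto simp: A_def B_def)
  have AB: "indep_var (PiM A N) (\<lambda>\<omega>. restrict (\<lambda>i. X i \<omega>) A) (PiM B N) (\<lambda>\<omega>. restrict (\<lambda>i. X i \<omega>) B)"
    by (rule indep_var_restrict[OF ind]) (auto simp: A_def B_def)
  have PiM: "PiM I N = count_space (PiE I (\<lambda>_. UNIV))" if "finite I" for I
    unfolding N_def using that by (intro count_space_PiM_finite) auto
  define LA where "LA y = {f \<in> PiE A (\<lambda>_. UNIV). \<forall>j\<le>n. lpp (\<lambda>i j. f (i, j)) m j = y j}" for y
  define WB where "WB c = {f \<in> PiE B (\<lambda>_. UNIV). \<forall>j<n. f (Suc m, Suc j) = c j}" for c :: "nat \<Rightarrow> nat"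
  have LA: "?L y m = (\<lambda>\<omega>. restrict (\<lambda>i. X i \<omega>) A) -` LA y \<inter> space M" for y
  proof -
    have "lpp (\<lambda>i j. restrict (\<lambda>i. X i \<omega>) A (i, j)) m j = lpp (\<lambda>i j. w i j \<omega>) m j" if "j \<le> n" for j \<omega>
      by (rule lpp_cong) (use that in \<open>auto simp: A_def X_def\<close>)
    then show ?thesis by (auto simp: LA_def)
  qed
  have WB: "?W c = (\<lambda>\<omega>. restrict (\<lambda>i. X i \<omega>) B) -` WB c \<inter> space M" for c
    by (auto simp: WB_def B_def X_def)
  have sets: "LA y \<in> sets (PiM A N)" "WB c \<in> sets (PiM B N)" for y c
    unfolding PiM[OF fin(1)] PiM[OF fin(2)] by (auto simp: LA_def WB_def)
  have events: "?L y m \<in> events" "?W c \<in> events" for y c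
    unfolding LA WB
    using indep_var_rv1[OF AB] indep_var_rv2[OF AB] sets by (auto intro: measurable_sets)
  have prob_W: "prob (?W c) = (\<Prod>j<n. (1 - q) * q ^ c j)" for c
  proof -
    have "?W c = (\<Inter>p\<in>B. X p -` {c (snd p - 1)} \<inter> space M)"
    proof (intro equalityI subsetI)
      fix \<omega> assume "\<omega> \<in> ?W c"
      then show "\<omega> \<in> (\<Inter>p\<in>B. X p -` {c (snd p - 1)} \<inter> space M)"
        by (auto simp: B_eq X_def)
    next
      fix \<omega> assume \<omega>: "\<omega> \<in> (\<Inter>p\<in>B. X p -` {c (snd p - 1)} \<inter> space M)"
      have pt: "X p \<omega> = c (snd p - 1) \<and> \<omega> \<in> space M" if "p \<in> B" for p
        using \<omega> that by blast
      show "\<omega> \<in> ?W c"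
        using n pt[of "(Suc m, Suc 0)"] pt[of "(Suc m, Suc _)"] by (simp add: B_def X_def)
    qed
    also have "prob \<dots> = (\<Prod>p\<in>B. prob (X p -` {c (snd p - 1)} \<inter> space M))"
      by (rule indep_varsD[OF ind]) (use n in \<open>auto simp: B_def N_def\<close>)
    also have "\<dots> = (\<Prod>p\<in>B. (1 - q) * q ^ c (snd p - 1))"
    proof (intro prod.cong refl)
      fix p assume "p \<in> B"
      then have "1 \<le> fst p" "1 \<le> snd p" by (auto simp: B_def)
      moreover have "X p -` {c (snd p - 1)} \<inter> space M = {\<omega> \<in> space M. w (fst p) (snd p) \<omega> = c (snd p - 1)}"
        by (auto simp: X_def split: prod.splits)
      ultimately show "prob (X p -` {c (snd p - 1)} \<inter> space M) = (1 - q) * q ^ c (snd p - 1)"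
        using geo by simp
    qed
    also have "\<dots> = (\<Prod>j<n. (1 - q) * q ^ c j)"
      by (rule prod.reindex_bij_witness[of _ "\<lambda>j. (Suc m, Suc j)" "\<lambda>p. snd p - 1"]) (auto simp: B_def)
    finally show ?thesis .
  qed
  have prob_LW: "prob (?L y m \<inter> ?W c) = prob (?L y m) * prob (?W c)" for y c
  proof -
    have "?L y m \<inter> ?W c = (\<lambda>\<omega>. (restrict (\<lambda>i. X i \<omega>) A, restrict (\<lambda>i. X i \<omega>) B)) -` (LA y \<times> WB c) \<inter> space M"
      unfolding LA WB by auto
    then show ?thesis
      using indep_varD[OF AB sets] unfolding LA WB by simp
  qed
  have IH: "complex_of_real (prob (?L y m)) = Determinant.det (mat n n (\<lambda>(j, i).
      neg_binomial_diff ?Q m (int (Suc j) - int i - 1) (int (y (Suc j)))))"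
    if y: "y \<in> chains n x" for y
    unfolding idx by (rule conjunct2[OF Suc.IH[of y, OF chainsD(1)[OF y] chainsD(2)[OF y]]])
  have ev: "?L x (Suc m) \<in> events"
    unfolding dec by (rule sets.finite_UN[OF finite_chains]) (rule sets.Int[OF events])
  have prob_sum: "prob (?L x (Suc m)) = (\<Sum>y\<in>chains n x. prob (?L y m \<inter> ?W (b y)))"
    unfolding dec
  proof (rule finite_measure_finite_Union)
    show "disjoint_family_on (\<lambda>y. ?L y m \<inter> ?W (b y)) (chains n x)"
      unfolding disjoint_family_on_def
    proof (intro ballI impI)
      fix y y' assume y: "y \<in> chains n x" "y' \<in> chains n x" "y \<noteq> y'"
      then obtain j where j: "y j \<noteq> y' j" by auto
      have "j \<le> n" using j y(1,2) chains_eq_0[of _ n x j] by (metis not_le)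
      then show "(?L y m \<inter> ?W (b y)) \<inter> (?L y' m \<inter> ?W (b y')) = {}"
      proof (intro equals0I)
        fix \<omega> assume "\<omega> \<in> (?L y m \<inter> ?W (b y)) \<inter> (?L y' m \<inter> ?W (b y'))"
        then have "lpp (\<lambda>i j. w i j \<omega>) m j = y j" "lpp (\<lambda>i j. w i j \<omega>) m j = y' j"
          using \<open>j \<le> n\<close> by blast+
        then show False using j by simp
      qed
    qed
    show "(\<lambda>y. ?L y m \<inter> ?W (b y)) ` chains n x \<subseteq> events"
      by (rule image_subsetI) (rule sets.Int[OF events])
  qed (rule finite_chains)
  have "complex_of_real (prob (?L x (Suc m))) = (\<Sum>y\<in>chains n x. complex_of_real (prob (?L y m)) *
      (\<Prod>j<n. (1 - ?Q) * ?Q ^ b y j))"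
    unfolding prob_sum by (simp add: prob_LW prob_W)
  also have "\<dots> = (\<Sum>y\<in>chains n x. Determinant.det (mat n n (\<lambda>(j, i).
      neg_binomial_diff ?Q m (int (Suc j) - int i - 1) (int (y (Suc j))))) * (\<Prod>j<n. (1 - ?Q) * ?Q ^ b y j))"
    by (intro sum.cong refl) (simp only: IH)
  also have "\<dots> = Determinant.det (mat n n (\<lambda>(j, i).
      neg_binomial_diff ?Q (Suc m) (int (Suc j) - int i - 1) (int (x (Suc j))) +
      (1 - ?Q) * ?Q ^ (x (Suc j) - x j) * neg_binomial_diff ?Q (Suc m) (int j - int i - 1) (int (x j))))"
    unfolding b_def
  proof (rule sum_chains_det[where h = "\<lambda>j t. (1 - ?Q) * ?Q ^ (x (Suc j) - max t (x j))"
      and e = "\<lambda>j i t. neg_binomial_diff ?Q m (int j - int i - 1) (int t)"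
      and \<kappa> = "\<lambda>j. (1 - ?Q) * ?Q ^ (x (Suc j) - x j)"])
    fix i j a assume "j < n" "i < n" "a \<le> x j"
    let ?g = "\<lambda>t. neg_binomial_diff ?Q m (int j - int i - 1) (int t)"
    let ?H = "\<lambda>t. neg_binomial_diff ?Q (Suc m) (int j - int i - 1) (int t)"
    have Suc_eq: "int (Suc j) - int i - 1 = (int j - int i - 1) + 1" by simp
    have d: "neg_binomial_diff ?Q k (int (Suc j) - int i - 1) (int t) =
       neg_binomial_diff ?Q k (int j - int i - 1) (int (Suc t)) -
       neg_binomial_diff ?Q k (int j - int i - 1) (int t)" for k t
      unfolding Suc_eq neg_binomial_diff_diff by (simp add: add.commute)
    have "?H (Suc t) - ?Q * ?H t = (1 - ?Q) * ?g (Suc t)" for t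
      using neg_binomial_diff_Suc[of ?Q m "int j - int i - 1" "int t"] by (simp add: add.commute)
    from geometric_step_sum[where g = ?g and H = ?H and q = ?Q, OF this \<open>a \<le> x j\<close> Suc.prems(2)[OF \<open>j < n\<close>]]
    show "(\<Sum>t\<in>{a..x (Suc j)}. (1 - ?Q) * ?Q ^ (x (Suc j) - max t (x j)) *
           neg_binomial_diff ?Q m (int (Suc j) - int i - 1) (int t)) =
       neg_binomial_diff ?Q (Suc m) (int (Suc j) - int i - 1) (int (x (Suc j))) +
      (1 - ?Q) * ?Q ^ (x (Suc j) - x j) * neg_binomial_diff ?Q (Suc m) (int j - int i - 1) (int (x j)) -
       (1 - ?Q) * ?Q ^ (x (Suc j) - x j) * neg_binomial_diff ?Q m (int j - int i - 1) (int a)"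
      unfolding d .
  qed (simp add: neg_binomial_diff_eq_0)
  also have "\<dots> = Determinant.det (mat n n (\<lambda>(j, i).
      neg_binomial_diff ?Q (Suc m) (int (Suc j) - int i - 1) (int (x (Suc j)))))"
    using Suc.prems(1)
    by (intro det_add_previous_rows[where t = "\<lambda>j i. neg_binomial_diff ?Q (Suc m) (int j - int i - 1) (int (x j))"])
       (simp add: neg_binomial_diff_eq_0)
  finally show ?case unfolding idx using ev by (rule conjI[rotated])
qed

text \<open>
  As \<open>G(m, j)\<close> increases with \<open>j\<close>, the event says that all values in the column are at most \<open>\<eta>\<close>. Summing
  the density over these chains shifts the order of the differences down by one.
\<close>

lemma lpp_distribution_eq_det:
  fixes w :: "nat \<Rightarrow> nat \<Rightarrow> 'a \<Rightarrow> nat" and q :: real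
  assumes indep: "indep_vars (\<lambda>_. count_space UNIV) (\<lambda>(i, j). w i j) ({1..} \<times> {1..})"
    and geo: "\<And>i j k. 1 \<le> i \<Longrightarrow> 1 \<le> j \<Longrightarrow> prob {\<omega> \<in> space M. w i j \<omega> = k} = (1 - q) * q ^ k"
    and n: "1 \<le> n"
  shows "complex_of_real (prob {\<omega> \<in> space M. lpp (\<lambda>i j. w i j \<omega>) m n \<le> \<eta>}) =
    Determinant.det (mat n n (\<lambda>(j, i).
      neg_binomial_diff (complex_of_real q) m (int j - int i - 1) (int \<eta> + 1)))"
proof -
  let ?Q = "complex_of_real q"
  let ?L = "\<lambda>x. {\<omega> \<in> space M. \<forall>j\<le>n. lpp (\<lambda>i j. w i j \<omega>) m j = x j}"
  define y where "y j = (if j = 0 then 0 else \<eta>)" for j :: nat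
  have idx: "int (Suc j) - int i - 1 = int j - int i" for i j by simp
  have density: "?L x \<in> events" "complex_of_real (prob (?L x)) = Determinant.det (mat n n (\<lambda>(j, i).
      neg_binomial_diff ?Q m (int (Suc j) - int i - 1) (int (x (Suc j)))))" if "x \<in> chains n y" for x
  proof -
    have "?L x \<in> events \<and> complex_of_real (prob (?L x)) = Determinant.det (mat n n (\<lambda>(j, i).
        neg_binomial_diff ?Q m (int j - int i) (int (x (Suc j)))))"
      by (rule lpp_column_density[OF indep _ n]) (simp_all only: geo chainsD(1,2)[OF that])
    then show "?L x \<in> events" "complex_of_real (prob (?L x)) = Determinant.det (mat n n (\<lambda>(j, i).
      neg_binomial_diff ?Q m (int (Suc j) - int i - 1) (int (x (Suc j)))))"
      unfolding idx by (rule conjunct1, rule conjunct2)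
  qed
  have dec: "{\<omega> \<in> space M. lpp (\<lambda>i j. w i j \<omega>) m n \<le> \<eta>} = (\<Union>x\<in>chains n y. ?L x)"
  proof (intro equalityI subsetI)
    fix \<omega> assume \<omega>: "\<omega> \<in> {\<omega> \<in> space M. lpp (\<lambda>i j. w i j \<omega>) m n \<le> \<eta>}"
    define x where "x j = (if j \<le> n then lpp (\<lambda>i j. w i j \<omega>) m j else 0)" for j
    have "x j \<le> y j" if "j \<le> n" for j
      using \<omega> lpp_mono_le[OF that, of "\<lambda>i j. w i j \<omega>" m] by (simp add: x_def y_def)
    then have "x \<in> chains n y"
      using lpp_mono by (simp add: chains_def) (simp add: x_def)
    then show "\<omega> \<in> (\<Union>x\<in>chains n y. ?L x)"
      using \<omega> by (intro UN_I[of x]) (auto simp: x_def)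
  next
    fix \<omega> assume "\<omega> \<in> (\<Union>x\<in>chains n y. ?L x)"
    then obtain x where "x n \<le> y n" "\<omega> \<in> space M" "lpp (\<lambda>i j. w i j \<omega>) m n = x n"
      using chainsD(3)[of _ n y n] by blast
    then show "\<omega> \<in> {\<omega> \<in> space M. lpp (\<lambda>i j. w i j \<omega>) m n \<le> \<eta>}"
      using n by (simp add: y_def)
  qed
  have prob_sum: "prob (\<Union>x\<in>chains n y. ?L x) = (\<Sum>x\<in>chains n y. prob (?L x))"
  proof (rule finite_measure_finite_Union)
    show "?L ` chains n y \<subseteq> events"
      by (rule image_subsetI) (rule density(1))
    show "disjoint_family_on ?L (chains n y)"
      unfolding disjoint_family_on_def
    proof (intro ballI impI)
      fix x x' assume x: "x \<in> chains n y" "x' \<in> chains n y" "x \<noteq> x'"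
      then obtain j where j: "x j \<noteq> x' j" by auto
      have "j \<le> n" using j x(1,2) chains_eq_0[of _ n y j] by (metis not_le)
      show "?L x \<inter> ?L x' = {}"
      proof (intro equals0I)
        fix \<omega> assume "\<omega> \<in> ?L x \<inter> ?L x'"
        then have "lpp (\<lambda>i j. w i j \<omega>) m j = x j" "lpp (\<lambda>i j. w i j \<omega>) m j = x' j"
          using \<open>j \<le> n\<close> by blast+
        then show False using j by simp
      qed
    qed
  qed (rule finite_chains)
  have "complex_of_real (prob {\<omega> \<in> space M. lpp (\<lambda>i j. w i j \<omega>) m n \<le> \<eta>}) =
     (\<Sum>x\<in>chains n y. Determinant.det (mat n n (\<lambda>(j, i).
      neg_binomial_diff ?Q m (int (Suc j) - int i - 1) (int (x (Suc j))))) * (\<Prod>j<n. 1))"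
    unfolding dec prob_sum of_real_sum by (intro sum.cong refl) (simp only: density(2) prod.neutral_const mult_1_right)
  also have "\<dots> = Determinant.det (mat n n (\<lambda>(j, i). neg_binomial_diff ?Q m (int j - int i - 1) (int \<eta> + 1)))"
  proof (rule sum_chains_det[where h = "\<lambda>j t. 1"
      and e = "\<lambda>j i t. neg_binomial_diff ?Q m (int j - int i - 1) (int t)" and \<kappa> = "\<lambda>j. 1"])
    fix i j a assume "a \<le> y j"
    have Suc_eq: "int (Suc j) - int i - 1 = (int j - int i - 1) + 1" by simp
    let ?g = "\<lambda>t. neg_binomial_diff ?Q m (int j - int i - 1) (int t)"
    have d: "neg_binomial_diff ?Q m (int (Suc j) - int i - 1) (int t) = ?g (Suc t) - ?g t" for t
      unfolding Suc_eq neg_binomial_diff_diff by (simp add: add.commute)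
    have "a \<le> Suc \<eta>" using \<open>a \<le> y j\<close> by (auto simp: y_def split: if_splits)
    then have "(\<Sum>t\<in>{a..\<eta>}. ?g (Suc t) - ?g t) = ?g (Suc \<eta>) - ?g a"
      by (rule sum_Suc_diff)
    then show "(\<Sum>t\<in>{a..y (Suc j)}. 1 * neg_binomial_diff ?Q m (int (Suc j) - int i - 1) (int t)) =
       neg_binomial_diff ?Q m (int j - int i - 1) (int \<eta> + 1) -
       1 * neg_binomial_diff ?Q m (int j - int i - 1) (int a)"
      unfolding d by (simp add: y_def add.commute)
  qed (simp add: neg_binomial_diff_eq_0)
  finally show ?thesis .
qed

end

section \<open>The biorthogonal functions\<close>

text \<open>
  The right factors of the kernel, \<open>\<psi>\<^sub>j = D\<^sup>j c\<^sub>m\<close>.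
\<close>

definition psi :: "'a::field \<Rightarrow> nat \<Rightarrow> nat \<Rightarrow> int \<Rightarrow> 'a" where
  "psi q m j x = fls_nth (fls_diff ^ j * fls_geo q ^ m) x"

text \<open>
  The power series \<open>(1 + v)\<^sup>-\<^sup>x (1 - q / (1 + v))\<^sup>m\<close> in \<open>v\<close>, whose coefficients \<open>\<phi>\<^sub>i x\<close> are the left factors
  of the kernel. They are polynomials of degree at most \<open>i\<close> in \<open>x\<close>.
\<close>

definition phi_fps :: "'a::field_char_0 \<Rightarrow> nat \<Rightarrow> int \<Rightarrow> 'a fps" where
  "phi_fps q m x = fps_binomial (of_int (- x)) * (1 - fps_const q * fps_binomial (- 1)) ^ m"

definition phi :: "'a::field_char_0 \<Rightarrow> nat \<Rightarrow> nat \<Rightarrow> int \<Rightarrow> 'a" where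
  "phi q m i x = fps_nth (phi_fps q m x) i"

lemma psi_Suc: "psi q m (Suc j) x = psi q m j (x + 1) - psi q m j x"
  by (simp add: psi_def mult.assoc fls_diff_mult_nth)

lemma psi_Suc_m: "psi q (Suc m) j x - q * psi q (Suc m) j (x - 1) = psi q m j x"
  using fls_geo_mult_nth[of q "fls_diff ^ j * fls_geo q ^ m" x]
  by (simp only: psi_def power_Suc mult_ac)

lemma psi_0_0: "psi q 0 0 x = (if x = 0 then 1 else 0)"
  by (simp add: psi_def)

lemma psi_eq_0: "x < - int j \<Longrightarrow> psi q m j x = 0"
  by (simp add: psi_def fls_subdegree_pow)

lemma phi_fps_shift: "phi_fps q m (x - 1) = (1 + fps_X) * phi_fps q m x"
proof -
  have "fps_binomial (of_int (- (x - 1))) = fps_binomial 1 * fps_binomial (of_int (- x) :: 'a)"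
    using fps_binomial_add_mult[of 1 "of_int (- x) :: 'a"] by (simp add: algebra_simps)
  then show ?thesis by (simp add: phi_fps_def fps_binomial_1 mult.assoc)
qed

lemma phi_shift_0: "phi q m 0 (x - 1) = phi q m 0 x"
  by (simp add: phi_def phi_fps_shift distrib_right)

lemma phi_shift_Suc: "phi q m (Suc i) (x - 1) = phi q m (Suc i) x + phi q m i x"
  by (simp add: phi_def phi_fps_shift distrib_right)

lemma phi_Suc_m: "phi q (Suc m) i x = phi q m i x - q * phi q m i (x + 1)"
proof -
  have "fps_binomial (of_int (- (x + 1))) = fps_binomial (- 1) * fps_binomial (of_int (- x) :: 'a)"
    using fps_binomial_add_mult[of "- 1" "of_int (- x) :: 'a"] by (simp add: algebra_simps)
  then have "phi_fps q (Suc m) x = phi_fps q m x - fps_const q * phi_fps q m (x + 1)"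
    by (simp add: phi_fps_def algebra_simps)
  then show ?thesis by (simp add: phi_def)
qed

lemma phi_0: "phi q 0 i x = of_int (- x) gchoose i"
  by (simp add: phi_def phi_fps_def)

text \<open>
  Repeated summation written as a single convolution with binomial coefficients. Both sides have the
  same differences in \<open>y\<close> by Pascal's rule, and both vanish at the left end.
\<close>

lemma fls_diff_neg_power_nth:
  fixes F :: "'a::field_char_0 fls"
  assumes F: "\<And>x. x < - int N \<Longrightarrow> fls_nth F x = 0" and y: "- int N - 1 \<le> y"
  shows "fls_nth (fls_diff powi (- int i - 1) * F) (y + 1) =
    (\<Sum>x\<in>{- int N..y}. fls_nth F x * (of_int (y - x) gchoose i))"
  using y
proof (induction i arbitrary: y)
  case (0 y)
  show ?case using 0
  proof (induction y rule: int_ge_induct)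
    case base
    have "F = 0 \<or> fls_subdegree F \<ge> - int N"
      using F by (meson fls_subdegree_geI)
    then have "fls_nth (fls_diff powi (- int 0 - 1) * F) (- int N) = 0"
      by (cases "F = 0") auto
    then show ?case by simp
  next
    case (step y)
    have "fls_nth (fls_diff powi (- int 0 - 1) * F) (y + 1 + 1) - fls_nth (fls_diff powi (- int 0 - 1) * F) (y + 1)
       = fls_nth (fls_diff * (fls_diff powi (- int 0 - 1) * F)) (y + 1)"
      by (simp only: fls_diff_mult_nth)
    also have "fls_diff * (fls_diff powi (- int 0 - 1) * F) = F"
      by (simp add: power_int_minus)
    finally have "fls_nth (fls_diff powi (- int 0 - 1) * F) (y + 1 + 1) =
       fls_nth (fls_diff powi (- int 0 - 1) * F) (y + 1) + fls_nth F (y + 1)"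
      by (simp add: algebra_simps)
    moreover have "{- int N..y + 1} = insert (y + 1) {- int N..y}" using step by auto
    ultimately show ?case using step by (simp add: add.commute)
  qed
next
  case (Suc i y)
  show ?case using Suc.prems
  proof (induction y rule: int_ge_induct)
    case base
    have "F = 0 \<or> fls_subdegree F \<ge> - int N"
      using F by (meson fls_subdegree_geI)
    then have "fls_nth (fls_diff powi (- int (Suc i) - 1) * F) (- int N) = 0"
      by (cases "F = 0") auto
    then show ?case by simp
  next
    case (step y)
    let ?D = "\<lambda>i. fls_diff powi (- int i - 1) * F"
    have "fls_nth (?D (Suc i)) (y + 1 + 1) - fls_nth (?D (Suc i)) (y + 1)
       = fls_nth (fls_diff * ?D (Suc i)) (y + 1)"
      by (simp only: fls_diff_mult_nth)
    also have "fls_diff * ?D (Suc i) = fls_diff powi (1 + (- int (Suc i) - 1)) * F"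
      unfolding mult.assoc[symmetric] by (subst power_int_add) auto
    also have "1 + (- int (Suc i) - 1) = - int i - 1" by simp
    finally have 1: "fls_nth (?D (Suc i)) (y + 1 + 1) =
        fls_nth (?D (Suc i)) (y + 1) + fls_nth (?D i) (y + 1)"
      by (simp add: algebra_simps)
    have iv: "{- int N..y + 1} = insert (y + 1) {- int N..y}" using step by auto
    have "(\<Sum>x\<in>{- int N..y + 1}. fls_nth F x * (of_int (y + 1 - x) gchoose Suc i)) =
      (\<Sum>x\<in>{- int N..y}. fls_nth F x * (of_int (y + 1 - x) gchoose Suc i))"
      unfolding iv by simp
    also have "\<dots> = (\<Sum>x\<in>{- int N..y}. fls_nth F x * (of_int (y - x) gchoose Suc i) +
        fls_nth F x * (of_int (y - x) gchoose i))"
    proof (intro sum.cong refl)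
      fix x
      have "(of_int (y + 1 - x) :: 'a) gchoose Suc i = (of_int (y - x) gchoose i) + (of_int (y - x) gchoose Suc i)"
        using gbinomial_addition_formula[of "of_int (y + 1 - x) :: 'a" i] by simp
      then show "fls_nth F x * (of_int (y + 1 - x) gchoose Suc i) =
        fls_nth F x * (of_int (y - x) gchoose Suc i) + fls_nth F x * (of_int (y - x) gchoose i)"
        by (simp add: algebra_simps)
    qed
    finally show ?case
      unfolding 1 step.IH Suc.IH[OF step.hyps] by (simp add: sum.distrib)
  qed
qed

text \<open>
  For \<open>x \<le> \<eta>\<close> the binomial coefficients from \<open>fls_diff_neg_power_nth\<close> are the coefficients of
  \<open>(1 + v)\<^sup>\<eta>\<^sup>-\<^sup>x\<close>. Multiplying by the series \<open>u = (1 - q)\<^sup>-\<^sup>m (1 + v)\<^sup>-\<^sup>\<eta> (1 - q / (1 + v))\<^sup>m\<close> with constant term \<open>1\<close> turns them into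
  \<open>(1 - q)\<^sup>-\<^sup>m \<phi>\<^sub>i x\<close>; on the level of coefficients this is a unitriangular operation. The lower limit \<open>- n\<close>
  covers the support of all \<open>\<psi>\<^sub>j\<close> with \<open>j < n\<close>.
\<close>

lemma det_neg_binomial_diff_eq_psi_phi:
  fixes q :: "'a::field_char_0"
  assumes q: "q \<noteq> 1"
  shows "Determinant.det (mat n n (\<lambda>(j, i). neg_binomial_diff q m (int j - int i - 1) (int \<eta> + 1))) =
    Determinant.det (mat n n (\<lambda>(j, i). \<Sum>x\<in>{- int n..int \<eta>}. psi q m j x * phi q m i x))"
proof -
  define T where "T j i = neg_binomial_diff q m (int j - int i - 1) (int \<eta> + 1)" for j i
  define u where "u = fps_const (inverse (1 - q) ^ m) * phi_fps q m (int \<eta>)"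
  define U where "U i k = (if k \<le> i then fps_nth u (i - k) else 0)" for i k
  have T: "T j i = (1 - q) ^ m * (\<Sum>x\<in>{- int n..int \<eta>}. psi q m j x * (of_int (int \<eta> - x) gchoose i))"
    if "j < n" for j i
  proof -
    have 1: "fls_diff powi (int j - int i - 1) * fls_geo q ^ m =
       fls_diff powi (- int i - 1) * (fls_diff ^ j * fls_geo q ^ m)"
      using power_int_add[of "fls_diff :: 'a fls" "int j" "- int i - 1"]
      by (simp add: algebra_simps)
    have 2: "fls_nth (fls_diff powi (- int i - 1) * (fls_diff ^ j * fls_geo q ^ m)) (int \<eta> + 1) =
       (\<Sum>x\<in>{- int n..int \<eta>}. fls_nth (fls_diff ^ j * fls_geo q ^ m) x * (of_int (int \<eta> - x) gchoose i))"
      by (rule fls_diff_neg_power_nth) (use that psi_eq_0[of _ j q m] in \<open>auto simp: psi_def\<close>)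
    show ?thesis unfolding T_def neg_binomial_diff_def psi_def 1 2 ..
  qed
  have "(\<Sum>k<n. U i k * T j k) = (\<Sum>x\<in>{- int n..int \<eta>}. psi q m j x * phi q m i x)"
    if "j < n" "i < n" for j i
  proof -
    have "(\<Sum>k<n. U i k * T j k) = (\<Sum>k\<le>i. fps_nth u (i - k) * T j k)"
      by (rule sum.mono_neutral_cong_right) (use that in \<open>auto simp: U_def\<close>)
    also have "\<dots> = (\<Sum>x\<in>{- int n..int \<eta>}. psi q m j x * ((1 - q) ^ m *
        (\<Sum>k\<le>i. (of_int (int \<eta> - x) gchoose k) * fps_nth u (i - k))))"
      unfolding T[OF that(1)] sum_distrib_left by (subst sum.swap) (simp add: mult_ac)
    also have "\<dots> = (\<Sum>x\<in>{- int n..int \<eta>}. psi q m j x * phi q m i x)"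
    proof (intro sum.cong refl arg_cong2[where f = "(*)"])
      fix x
      have "(1 - q) ^ m * (\<Sum>k\<le>i. (of_int (int \<eta> - x) gchoose k) * fps_nth u (i - k)) =
         fps_nth (fps_const ((1 - q) ^ m) * (fps_binomial (of_int (int \<eta> - x)) * u)) i"
        unfolding fps_mult_left_const_nth fps_mult_nth[of "fps_binomial _"]
        by (simp add: atMost_atLeast0)
      also have "fps_const ((1 - q) ^ m) * (fps_binomial (of_int (int \<eta> - x)) * u) = phi_fps q m x"
      proof -
        have 1: "fps_const ((1 - q) ^ m) * fps_const (inverse (1 - q) ^ m) = (1 :: 'a fps)"
          using q by (simp flip: power_mult_distrib)
        have 2: "fps_binomial (of_int (int \<eta> - x)) * fps_binomial (of_int (- int \<eta>)) =
            fps_binomial (of_int (- x) :: 'a)"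
          using fps_binomial_add_mult[of "of_int (int \<eta> - x)" "of_int (- int \<eta>) :: 'a"] by simp
        have "fps_const ((1 - q) ^ m) * (fps_binomial (of_int (int \<eta> - x)) * u) =
          (fps_const ((1 - q) ^ m) * fps_const (inverse (1 - q) ^ m)) *
          ((fps_binomial (of_int (int \<eta> - x)) * fps_binomial (of_int (- int \<eta>))) *
           (1 - fps_const q * fps_binomial (- 1)) ^ m)"
          by (simp only: u_def phi_fps_def mult_ac)
        then show ?thesis unfolding 1 2 by (simp add: phi_fps_def)
      qed
      finally show "(1 - q) ^ m * (\<Sum>k\<le>i. (of_int (int \<eta> - x) gchoose k) * fps_nth u (i - k)) = phi q m i x"
        by (simp only: phi_def)
    qed
    finally show ?thesis .
  qed
  then have "mat n n (\<lambda>(j, i). \<Sum>x\<in>{- int n..int \<eta>}. psi q m j x * phi q m i x) =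
      mat n n (\<lambda>(j, i). \<Sum>k<n. U i k * T j k)"
    by (intro eq_matI) auto
  moreover have "U i i = 1" for i
    using q by (simp add: U_def u_def phi_fps_def fps_power_zeroth flip: power_mult_distrib)
  ultimately show ?thesis
    using det_unitriangular_mult_right[of n U T] by (simp add: U_def T_def)
qed

text \<open>
  The generating function of \<open>\<psi>\<^sub>j\<close> converges up to radius \<open>1 / q\<close>; the bound is read off the recurrence
  in \<open>m\<close>, where each step costs a factor \<open>1 / (1 - q s)\<close>.
\<close>

lemma norm_psi_le:
  fixes q s :: real
  assumes q: "0 < q" and s: "0 < s" "q * s < 1"
  obtains C where "0 \<le> C" "\<And>x. norm (psi (complex_of_real q) m j x) \<le> C * s powi (- x)"
proof -
  let ?Q = "complex_of_real q"
  have "\<exists>C\<ge>0. \<forall>x. norm (psi ?Q m j x) \<le> C * s powi (- x)"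
  proof (induction j)
    case 0
    show ?case
    proof (induction m)
      case 0
      show ?case by (rule exI[of _ 1]) (use s in \<open>auto simp: psi_0_0\<close>)
    next
      case (Suc m)
      then obtain C where C: "C \<ge> 0" "\<And>x. norm (psi ?Q m 0 x) \<le> C * s powi (- x)" by auto
      define C' where "C' = C / (1 - q * s)"
      have C': "C' \<ge> 0" "C + q * s * C' = C'"
        using C(1) s by (auto simp: C'_def field_simps)
      have "norm (psi ?Q (Suc m) 0 x) \<le> C' * s powi (- x)" for x
      proof (cases "x < 0")
        case True
        then show ?thesis using psi_eq_0[of x 0 ?Q "Suc m"] C' s by simp
      next
        case False
        then have "-1 \<le> x" by simp
        then show ?thesis
        proof (induction x rule: int_ge_induct)
          case base
          show ?case using psi_eq_0[of "-1" 0 ?Q "Suc m"] C' s by simp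
        next
          case (step x)
          have "psi ?Q (Suc m) 0 (x + 1) = psi ?Q m 0 (x + 1) + ?Q * psi ?Q (Suc m) 0 x"
            using psi_Suc_m[of ?Q m 0 "x + 1"] by (simp add: algebra_simps)
          then have "norm (psi ?Q (Suc m) 0 (x + 1)) \<le> norm (psi ?Q m 0 (x + 1)) + q * norm (psi ?Q (Suc m) 0 x)"
            using norm_triangle_ineq[of "psi ?Q m 0 (x + 1)" "?Q * psi ?Q (Suc m) 0 x"] q
            by (simp add: norm_mult)
          also have "\<dots> \<le> C * s powi (- (x + 1)) + q * (C' * s powi (- x))"
            using q by (intro add_mono mult_left_mono C(2) step.IH) simp
          also have "s powi (- x) = s * s powi (- (x + 1))"
            using s power_int_add[of s 1 "- (x + 1)"] by simp
          also have "C * s powi (- (x + 1)) + q * (C' * (s * s powi (- (x + 1)))) =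
             (C + q * s * C') * s powi (- (x + 1))" by (simp add: algebra_simps)
          finally show ?case using C' by simp
        qed
      qed
      then show ?case using C'(1) by blast
    qed
  next
    case (Suc j)
    then obtain C where C: "C \<ge> 0" "\<And>x. norm (psi ?Q m j x) \<le> C * s powi (- x)" by auto
    have "norm (psi ?Q m (Suc j) x) \<le> (C / s + C) * s powi (- x)" for x
    proof -
      have "norm (psi ?Q m (Suc j) x) \<le> norm (psi ?Q m j (x + 1)) + norm (psi ?Q m j x)"
        unfolding psi_Suc by (rule norm_triangle_ineq4)
      also have "\<dots> \<le> C * s powi (- (x + 1)) + C * s powi (- x)"
        by (intro add_mono C(2))
      also have "s powi (- x) = s * s powi (- (x + 1))"
        using s power_int_add[of s 1 "- (x + 1)"] by simp
      also have "C * s powi (- (x + 1)) + C * (s * s powi (- (x + 1))) =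
          (C / s + C) * (s * s powi (- (x + 1)))"
        using s by (simp add: field_simps)
      finally show ?thesis
        using s power_int_add[of s 1 "- (x + 1)"] by simp
    qed
    moreover have "C / s + C \<ge> 0" using C s by simp
    ultimately show ?case by blast
  qed
  then show ?thesis using that by blast
qed

text \<open>
  Polynomial growth in \<open>x\<close>, stated as growth slower than any \<open>r\<^sup>x\<close> with \<open>r > 1\<close>, which is what the
  recurrences reproduce.
\<close>

lemma norm_phi_le:
  fixes q r :: real
  assumes q: "0 < q" and r: "1 < r"
  obtains C where "0 \<le> C" "\<And>x :: nat. norm (phi (complex_of_real q) m i (int x)) \<le> C * r ^ x"
proof -
  let ?Q = "complex_of_real q"
  have "\<exists>C\<ge>0. \<forall>x :: nat. norm (phi ?Q m i (int x)) \<le> C * r ^ x"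
  proof (induction m)
    case 0
    show ?case
    proof (induction i)
      case 0
      show ?case by (rule exI[of _ 1]) (use r in \<open>simp add: phi_0\<close>)
    next
      case (Suc i)
      then obtain C where C: "C \<ge> 0" "\<And>x :: nat. norm (phi ?Q 0 i (int x)) \<le> C * r ^ x" by auto
      define C' where "C' = C * r / (r - 1)"
      have C': "C' \<ge> 0" "C' + C * r = C' * r"
        using C(1) r by (auto simp: C'_def field_simps)
      have "norm (phi ?Q 0 (Suc i) (int x)) \<le> C' * r ^ x" for x
      proof (induction x)
        case 0
        then show ?case using C' by (simp add: phi_0 del: gbinomial_Suc)
      next
        case (Suc x)
        have "phi ?Q 0 (Suc i) (int (Suc x)) = phi ?Q 0 (Suc i) (int x) - phi ?Q 0 i (int (Suc x))"
          using phi_shift_Suc[of ?Q 0 i "int (Suc x)"] by simp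
        then have "norm (phi ?Q 0 (Suc i) (int (Suc x))) \<le>
            norm (phi ?Q 0 (Suc i) (int x)) + norm (phi ?Q 0 i (int (Suc x)))"
          using norm_triangle_ineq4 by metis
        also have "\<dots> \<le> C' * r ^ x + C * r ^ Suc x"
          by (intro add_mono Suc C(2))
        also have "\<dots> = (C' + C * r) * r ^ x" by (simp add: algebra_simps)
        finally show ?case unfolding C' by simp
      qed
      then show ?case using C' by blast
    qed
  next
    case (Suc m)
    then obtain C where C: "C \<ge> 0" "\<And>x :: nat. norm (phi ?Q m i (int x)) \<le> C * r ^ x" by auto
    have "norm (phi ?Q (Suc m) i (int x)) \<le> (C + q * C * r) * r ^ x" for x
    proof -
      have "norm (phi ?Q (Suc m) i (int x)) \<le> norm (phi ?Q m i (int x)) + q * norm (phi ?Q m i (int (Suc x)))"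
        using norm_triangle_ineq4[of "phi ?Q m i (int x)" "?Q * phi ?Q m i (int x + 1)"] q
        by (simp add: phi_Suc_m norm_mult add.commute)
      also have "\<dots> \<le> C * r ^ x + q * (C * r ^ Suc x)"
        using q by (intro add_mono mult_left_mono C(2)) simp
      finally show ?thesis by (simp add: algebra_simps)
    qed
    moreover have "C + q * C * r \<ge> 0" using C q r by simp
    ultimately show ?case by blast
  qed
  then show ?thesis using that by blast
qed

lemma abs_summable_psi_phi:
  fixes q :: real
  assumes q: "0 < q" "q < 1"
  shows "(\<lambda>x. norm (psi (complex_of_real q) m j x * phi (complex_of_real q) m' i x)) summable_on UNIV"
proof -
  let ?f = "\<lambda>x. norm (psi (complex_of_real q) m j x * phi (complex_of_real q) m' i x)"
  (* Any 1 < r < s < 1 / q will do: the terms then decay like (r / s) ^ x. *)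
  define s where "s = 1 / sqrt q"
  define r where "r = sqrt s"
  have s: "1 < s" "q * s < 1"
  proof -
    have "sqrt q < 1" "0 < sqrt q" using q by auto
    then show "1 < s" by (simp add: s_def)
    have "q * s = sqrt q" using q by (simp add: s_def real_div_sqrt)
    then show "q * s < 1" using \<open>sqrt q < 1\<close> by simp
  qed
  have r: "1 < r" "r < s"
    using s real_sqrt_less_mono[of s "s * s"] by (simp_all add: r_def)
  have s0: "0 < s" using s by simp
  obtain C where C: "0 \<le> C" "\<And>x. norm (psi (complex_of_real q) m j x) \<le> C * s powi (- x)"
    by (rule norm_psi_le[where m = m and j = j, OF q(1) s0 s(2)]) blast
  obtain D where D: "0 \<le> D" "\<And>x :: nat. norm (phi (complex_of_real q) m' i (int x)) \<le> D * r ^ x"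
    by (rule norm_phi_le[where m = m' and i = i, OF q(1) r(1)]) blast
  have "(\<lambda>x :: nat. ?f (int x)) summable_on UNIV"
  proof (rule summable_nonneg_imp_summable_on)
    show "summable (\<lambda>x :: nat. ?f (int x))"
    proof (rule summable_comparison_test)
      show "summable (\<lambda>x. C * D * (r / s) ^ x)"
        using r s by (intro summable_mult summable_geometric) auto
      have "?f (int x) \<le> C * D * (r / s) ^ x" for x :: nat
      proof -
        have "?f (int x) \<le> (C * s powi (- int x)) * (D * r ^ x)"
          unfolding norm_mult using C D s by (intro mult_mono) auto
        also have "\<dots> = C * D * (r / s) ^ x"
          by (simp add: power_int_minus power_divide field_simps)
        finally show ?thesis .
      qed
      then show "\<exists>N. \<forall>x\<ge>N. norm (?f (int x)) \<le> C * D * (r / s) ^ x" by simp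
    qed
  qed simp
  then have "?f summable_on {0..}"
    by (subst summable_on_reindex_bij_betw[of int UNIV "{0..}", symmetric])
       (auto simp: bij_betw_def intro: range_eqI[of _ _ "nat _"])
  moreover have "?f summable_on {- int j..<0}" by (rule summable_on_finite) simp
  ultimately have "?f summable_on ({0..} \<union> {- int j..<0})"
    by (intro summable_on_Un_disjoint) auto
  also have "?this \<longleftrightarrow> ?f summable_on UNIV"
    by (rule summable_on_cong_neutral) (auto simp: psi_eq_0)
  finally show ?thesis .
qed

lemma has_sum_diff:
  fixes f g :: "'b \<Rightarrow> 'a::topological_ab_group_add"
  assumes "(f has_sum a) A" "(g has_sum b) A"
  shows "((\<lambda>x. f x - g x) has_sum (a - b)) A"
proof -
  have "((\<lambda>x. - g x) has_sum - b) A" using assms(2) by (simp add: has_sum_uminus)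
  from has_sum_add[OF assms(1) this] show ?thesis by simp
qed

lemma has_sum_int_shift:
  fixes f :: "int \<Rightarrow> 'a::{comm_monoid_add, topological_space}"
  shows "((\<lambda>x. f (x + 1)) has_sum S) UNIV \<longleftrightarrow> (f has_sum S) UNIV"
  by (rule has_sum_reindex_bij_betw) (rule bij_plus_right)

text \<open>
  Both index shifts are summation by parts without boundary terms. Moving a difference from \<open>\<psi>\<^sub>j\<^sub>+\<^sub>1\<close> to
  \<open>\<phi>\<^sub>i\<close> gives \<open>\<phi>\<^sub>i\<^sub>-\<^sub>1\<close>, which reduces the claim to \<open>j = 0\<close>. Moving the factor \<open>1 - q X\<close> from \<open>\<phi>\<close> to \<open>\<psi>\<close> lowers \<open>m\<close> on
  both sides, which reduces it to \<open>m = 0\<close>, where \<open>\<psi>\<^sub>0\<close> is the unit mass at \<open>0\<close>.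
\<close>

lemma has_sum_psi_phi:
  fixes q :: real
  assumes q: "0 < q" "q < 1"
  shows "((\<lambda>x. psi (complex_of_real q) m j x * phi (complex_of_real q) m i x) has_sum
     (if i = j then 1 else 0)) UNIV"
proof -
  let ?Q = "complex_of_real q"
  define S where "S m m' j i = (\<Sum>\<^sub>\<infinity>x. psi ?Q m j x * phi ?Q m' i x)" for m m' j i
  have S: "((\<lambda>x. psi ?Q m j x * phi ?Q m' i x) has_sum S m m' j i) UNIV" for m m' j i
    unfolding S_def by (rule has_sum_infsum, rule abs_summable_summable, rule abs_summable_psi_phi[OF q])
  have S0: "S m m 0 i = (if i = 0 then 1 else 0)" for m i
  proof (induction m)
    case 0
    have "((\<lambda>x. psi ?Q 0 0 x * phi ?Q 0 i x) has_sum (if i = 0 then 1 else 0)) UNIV"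
      by (rule has_sum_finite_neutralI[of "{0}"]) (simp_all add: psi_0_0 phi_0 gbinomial_0_left)
    then show ?case by (rule has_sum_unique[OF S])
  next
    case (Suc m)
    have "((\<lambda>x. psi ?Q (Suc m) 0 x * phi ?Q m i x - psi ?Q m 0 x * phi ?Q m i x) has_sum
        (S (Suc m) m 0 i - S m m 0 i)) UNIV"
      by (intro has_sum_diff S)
    also have "(\<lambda>x. psi ?Q (Suc m) 0 x * phi ?Q m i x - psi ?Q m 0 x * phi ?Q m i x) =
        (\<lambda>x. ?Q * psi ?Q (Suc m) 0 (x - 1) * phi ?Q m i x)"
      by (simp only: psi_Suc_m[symmetric, of ?Q m]) (simp add: algebra_simps)
    finally have "((\<lambda>x. ?Q * psi ?Q (Suc m) 0 x * phi ?Q m i (x + 1)) has_sum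
        (S (Suc m) m 0 i - S m m 0 i)) UNIV"
      using has_sum_int_shift[of "\<lambda>x. ?Q * psi ?Q (Suc m) 0 (x - 1) * phi ?Q m i x"] by simp
    then have "((\<lambda>x. psi ?Q (Suc m) 0 x * phi ?Q m i x - ?Q * psi ?Q (Suc m) 0 x * phi ?Q m i (x + 1)) has_sum
        (S (Suc m) m 0 i - (S (Suc m) m 0 i - S m m 0 i))) UNIV"
      by (intro has_sum_diff S)
    then have "((\<lambda>x. psi ?Q (Suc m) 0 x * phi ?Q (Suc m) i x) has_sum S m m 0 i) UNIV"
      by (simp add: phi_Suc_m algebra_simps)
    then show ?case using has_sum_unique[OF S[of "Suc m" 0 "Suc m" i]] Suc by simp
  qed
  have SSuc: "S m m (Suc j) i = (if i = 0 then 0 else S m m j (i - 1))" for m j i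
  proof -
    have "((\<lambda>x. psi ?Q m j x * phi ?Q m i (x - 1)) has_sum
       (S m m j i + (if i = 0 then 0 else S m m j (i - 1)))) UNIV"
    proof (cases i)
      case 0
      then show ?thesis using S[of m j m 0] by (simp add: phi_shift_0)
    next
      case (Suc i')
      then show ?thesis using has_sum_add[OF S[of m j m i] S[of m j m i']]
        by (simp add: phi_shift_Suc algebra_simps)
    qed
    then have "((\<lambda>x. psi ?Q m j (x + 1) * phi ?Q m i x) has_sum
       (S m m j i + (if i = 0 then 0 else S m m j (i - 1)))) UNIV"
      using has_sum_int_shift[of "\<lambda>x. psi ?Q m j x * phi ?Q m i (x - 1)"] by simp
    from has_sum_diff[OF this S[of m j m i]]
    have "((\<lambda>x. psi ?Q m (Suc j) x * phi ?Q m i x) has_sum (if i = 0 then 0 else S m m j (i - 1))) UNIV"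
      by (simp add: psi_Suc algebra_simps)
    then show ?thesis by (rule has_sum_unique[OF S])
  qed
  have "S m m j i = (if i = j then 1 else 0)" for m j i
  proof (induction j arbitrary: i)
    case (Suc j)
    then show ?case by (cases i) (simp_all add: SSuc)
  qed (simp add: S0)
  then show ?thesis using S[of m j m i] by simp
qed

lemma sum_psi_phi_eq:
  fixes q :: real
  assumes q: "0 < q" "q < 1" and j: "j < n"
  shows "(\<Sum>x\<in>{- int n..int \<eta>}. psi (complex_of_real q) m j x * phi (complex_of_real q) m i x) =
    (if j = i then 1 else 0) -
    (\<Sum>\<^sub>\<infinity>x\<in>{int \<eta> + 1..}. psi (complex_of_real q) m j x * phi (complex_of_real q) m i x)"
proof -
  let ?f = "\<lambda>x. psi (complex_of_real q) m j x * phi (complex_of_real q) m i x"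
  have "(?f has_sum (if i = j then 1 else 0)) ({- int n..int \<eta>} \<union> {int \<eta> + 1..})"
    using has_sum_psi_phi[OF q, of m j i] j
    by (subst has_sum_cong_neutral[of UNIV _ ?f ?f]) (auto intro!: psi_eq_0)
  moreover have "?f summable_on {int \<eta> + 1..}"
    by (rule summable_on_subset_banach[OF abs_summable_summable[OF abs_summable_psi_phi[OF q]]]) simp
  then have "(?f has_sum ((\<Sum>x\<in>{- int n..int \<eta>}. ?f x) + (\<Sum>\<^sub>\<infinity>x\<in>{int \<eta> + 1..}. ?f x)))
      ({- int n..int \<eta>} \<union> {int \<eta> + 1..})"
    by (intro has_sum_Un_disjoint has_sum_finite has_sum_infsum) simp_all
  ultimately have "(if i = j then 1 else 0) = (\<Sum>x\<in>{- int n..int \<eta>}. ?f x) + (\<Sum>\<^sub>\<infinity>x\<in>{int \<eta> + 1..}. ?f x)"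
    by (rule has_sum_unique)
  then show ?thesis by (auto simp: algebra_simps)
qed

section \<open>The kernel as a sum of products\<close>

lemma has_contour_integral_circle_holomorphic:
  assumes f: "f holomorphic_on ball 0 R" and r: "0 < r" "r < R"
  shows "(f has_contour_integral 0) (circlepath 0 r)"
  by (rule Cauchy_theorem_disc_simple[OF f]) (use r in \<open>auto simp: path_image_circlepath\<close>)

lemma has_contour_integral_pole:
  assumes "dist a 0 < r"
  shows "((\<lambda>u. c / (u - a) ^ Suc k) has_contour_integral (if k = 0 then 2 * of_real pi * \<i> * c else 0))
           (circlepath 0 r)"
proof -
  have "((\<lambda>u. c / (u - a) ^ Suc k) has_contour_integral
     (2 * pi * \<i>) / fact k * (deriv ^^ k) (\<lambda>_. c) a) (circlepath 0 r)"
    by (rule Cauchy_has_contour_integral_higher_derivative_circlepath)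
       (use assms in \<open>auto intro!: holomorphic_intros continuous_intros simp: dist_commute\<close>)
  then show ?thesis by (auto simp: higher_deriv_const split: if_splits)
qed

lemma power_int_minus_shift:
  fixes w :: complex
  assumes "w \<noteq> 0"
  shows "w powi (- y - 1) = w * w powi (- (y + 1) - 1)"
proof -
  have e: "- y - 1 = 1 + (- (y + 1) - 1)" by simp
  show ?thesis unfolding e by (subst power_int_add) (use assms in auto)
qed

text \<open>
  Coefficient extraction by a contour integral. It is proved by the recurrences that define \<open>psi\<close>:
  \<open>1 / w - 1\<close> acts as a difference in \<open>y\<close>, and \<open>1 - q w\<close> removes one factor of the denominator. The integrals for
  \<open>y < 0\<close> vanish because the integrand is holomorphic inside \<open>1 / q\<close>.
\<close>

lemma has_contour_integral_psi:
  assumes q: "0 < q" and r: "0 < r" "r < 1 / q"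
  shows "((\<lambda>w. (1 / w - 1) ^ j * w powi (- y - 1) / (1 - of_real q * w) ^ m) has_contour_integral
      2 * of_real pi * \<i> * psi (complex_of_real q) m j y) (circlepath 0 r)"
proof -
  let ?Q = "complex_of_real q"
  define f where "f m j y w = (1 / w - 1) ^ j * w powi (- y - 1) / (1 - ?Q * w) ^ m" for m j and y :: int and w
  have nz: "w \<noteq> 0" "1 - ?Q * w \<noteq> 0" if "w \<in> path_image (circlepath 0 r)" for w
  proof -
    have w: "norm w = r" using that r by (simp add: path_image_circlepath)
    then show "w \<noteq> 0" using r by auto
    have "norm (?Q * w) < 1" using w q r by (simp add: norm_mult field_simps)
    then show "1 - ?Q * w \<noteq> 0" by auto
  qed
  have neg: "(f m 0 y has_contour_integral 0) (circlepath 0 r)" if "y < 0" for m y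
  proof -
    have eq: "f m 0 y = (\<lambda>w. w ^ nat (- y - 1) / (1 - ?Q * w) ^ m)"
      using that by (auto simp: f_def power_int_def)
    have "1 - ?Q * w \<noteq> 0" if "w \<in> ball 0 (1 / q)" for w
    proof -
      have "norm (?Q * w) < 1" using that q by (simp add: norm_mult field_simps)
      then show ?thesis by auto
    qed
    then show ?thesis
      unfolding eq by (intro has_contour_integral_circle_holomorphic[OF _ r] holomorphic_intros) auto
  qed
  have "(f m j y has_contour_integral 2 * of_real pi * \<i> * psi ?Q m j y) (circlepath 0 r)"
  proof (induction j arbitrary: y)
    case 0
    show ?case
    proof (induction m arbitrary: y)
      case 0
      show ?case
      proof (cases "y < 0")
        case True
        then show ?thesis using neg[of y 0] by (simp add: psi_0_0)
      next
        case False
        have eq: "f 0 0 y = (\<lambda>w. 1 / (w - 0) ^ Suc (nat y))"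
          using False by (auto simp: f_def power_int_def divide_inverse power_inverse nat_add_distrib)
        show ?thesis
          unfolding eq using has_contour_integral_pole[of 0 r 1 "nat y"] r False
          by (auto simp: psi_0_0)
      qed
    next
      case (Suc m)
      show ?case
      proof (cases "y < 0")
        case True
        then show ?thesis using neg[of y "Suc m"] psi_eq_0[of y 0 ?Q "Suc m"] by simp
      next
        case False
        then have "-1 \<le> y" by simp
        then show ?thesis
        proof (induction y rule: int_ge_induct)
          case base
          show ?case using neg[of "-1" "Suc m"] psi_eq_0[of "-1" 0 ?Q "Suc m"] by simp
        next
          case (step y)
          have psi: "psi ?Q (Suc m) 0 (y + 1) = psi ?Q m 0 (y + 1) + ?Q * psi ?Q (Suc m) 0 y"
            using psi_Suc_m[of ?Q m 0 "y + 1"] by (simp add: algebra_simps)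
          have "((\<lambda>w. f m 0 (y + 1) w + ?Q * f (Suc m) 0 y w) has_contour_integral
             2 * of_real pi * \<i> * psi ?Q m 0 (y + 1) + ?Q * (2 * of_real pi * \<i> * psi ?Q (Suc m) 0 y)) (circlepath 0 r)"
            by (intro has_contour_integral_add has_contour_integral_lmul Suc.IH step.IH)
          then have "(f (Suc m) 0 (y + 1) has_contour_integral
             2 * of_real pi * \<i> * psi ?Q m 0 (y + 1) + ?Q * (2 * of_real pi * \<i> * psi ?Q (Suc m) 0 y)) (circlepath 0 r)"
          proof (rule has_contour_integral_eq)
            fix w assume w: "w \<in> path_image (circlepath 0 r)"
            have "w powi (- y - 1) = w * w powi (- (y + 1) - 1)"
              by (rule power_int_minus_shift) (use nz[OF w] in simp)
            then show "f m 0 (y + 1) w + ?Q * f (Suc m) 0 y w = f (Suc m) 0 (y + 1) w"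
              using nz[OF w] by (simp add: f_def divide_simps) (simp add: algebra_simps)
          qed
          then show ?case by (simp only: psi ring_distribs mult_ac)
        qed
      qed
    qed
  next
    case (Suc j)
    have "((\<lambda>w. f m j (y + 1) w - f m j y w) has_contour_integral
       2 * of_real pi * \<i> * psi ?Q m j (y + 1) - 2 * of_real pi * \<i> * psi ?Q m j y) (circlepath 0 r)"
      by (intro has_contour_integral_diff Suc.IH)
    then have "(f m (Suc j) y has_contour_integral
       2 * of_real pi * \<i> * psi ?Q m j (y + 1) - 2 * of_real pi * \<i> * psi ?Q m j y) (circlepath 0 r)"
    proof (rule has_contour_integral_eq)
      fix w assume w: "w \<in> path_image (circlepath 0 r)"
      have "w powi (- y - 1) = w * w powi (- (y + 1) - 1)"
        by (rule power_int_minus_shift) (use nz[OF w] in simp)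
      then show "f m j (y + 1) w - f m j y w = f m (Suc j) y w"
        using nz[OF w] by (simp add: f_def divide_simps) (simp add: algebra_simps)
    qed
    then show ?case by (simp only: psi_Suc right_diff_distrib)
  qed
  then show ?thesis by (simp add: f_def[abs_def])
qed

text \<open>
  The residue at \<open>z = 1\<close> by Pascal's rule, from \<open>z\<^sup>p\<^sup>+\<^sup>1 = z\<^sup>p - z\<^sup>p (1 - z)\<close>.
\<close>

lemma has_contour_integral_power_over_pole:
  assumes r: "1 < r"
  shows "((\<lambda>z. z ^ p / (1 - z) ^ l) has_contour_integral
     (if l = 0 then 0 else 2 * of_real pi * \<i> * ((- 1) ^ l * of_nat (p choose (l - 1))))) (circlepath 0 r)"
proof (induction p arbitrary: l)
  case 0
  show ?case
  proof (cases l)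
    case 0
    then show ?thesis
      using has_contour_integral_circle_holomorphic[of "\<lambda>_. 1" "r + 1" r] r by simp
  next
    case (Suc k)
    have "(\<lambda>z :: complex. z ^ 0 / (1 - z) ^ l) = (\<lambda>z. (- 1) ^ l / (z - 1) ^ Suc k)"
    proof (rule ext)
      fix z :: complex
      have "(1 - z) ^ l = (- 1) ^ l * (z - 1) ^ l" by (simp flip: power_mult_distrib)
      then show "z ^ 0 / (1 - z) ^ l = (- 1) ^ l / (z - 1) ^ Suc k" using Suc by (simp add: divide_simps)
    qed
    then show ?thesis
      using has_contour_integral_pole[of 1 r "(- 1) ^ l" k] r Suc by (cases k) simp_all
  qed
next
  case (Suc p)
  show ?case
  proof (cases l)
    case 0
    have "(\<lambda>z. z ^ Suc p) holomorphic_on ball 0 (r + 1)" by (intro holomorphic_intros)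
    from has_contour_integral_circle_holomorphic[OF this, of r] show ?thesis
      using r 0 by simp
  next
    case (Suc k)
    have "((\<lambda>z. z ^ p / (1 - z) ^ l - z ^ p / (1 - z) ^ k) has_contour_integral
      2 * of_real pi * \<i> * ((- 1) ^ l * of_nat (p choose k)) -
      (if k = 0 then 0 else 2 * of_real pi * \<i> * ((- 1) ^ k * of_nat (p choose (k - 1))))) (circlepath 0 r)"
      using has_contour_integral_diff[OF Suc.IH[of l] Suc.IH[of k]] Suc by simp
    moreover have "z ^ p / (1 - z) ^ l - z ^ p / (1 - z) ^ k = z ^ Suc p / (1 - z) ^ l"
      if "z \<in> path_image (circlepath 0 r)" for z
    proof -
      have "1 - z \<noteq> 0" using that r by (auto simp: path_image_circlepath)
      then show ?thesis using Suc by (simp add: divide_simps) (simp add: algebra_simps)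
    qed
    ultimately have "((\<lambda>z. z ^ Suc p / (1 - z) ^ l) has_contour_integral
      2 * of_real pi * \<i> * ((- 1) ^ l * of_nat (p choose k)) -
      (if k = 0 then 0 else 2 * of_real pi * \<i> * ((- 1) ^ k * of_nat (p choose (k - 1))))) (circlepath 0 r)"
      by (rule has_contour_integral_eq)
    then show ?thesis using Suc by (cases k) (auto simp: algebra_simps)
  qed
qed

text \<open>
  In the variable \<open>v = 1 / z - 1\<close> this is the residue at \<open>v = 0\<close> that extracts the coefficient of \<open>v\<^sup>i\<close>, and
  \<open>dz = - z\<^sup>2 dv\<close> explains both the sign and the exponent \<open>x - 2\<close>. For \<open>m = 0\<close> it is an explicit
  binomial coefficient, and \<open>1 - q z\<close> acts through the shift of \<open>x\<close>.
\<close>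

lemma has_contour_integral_phi:
  assumes r: "1 < r" and x: "1 \<le> x"
  shows "((\<lambda>z. z powi (x - 2) * (z / (1 - z)) ^ Suc i * (1 - of_real q * z) ^ m) has_contour_integral
      - (2 * of_real pi * \<i>) * phi (complex_of_real q) m i x) (circlepath 0 r)"
  using x
proof (induction m arbitrary: x)
  case 0
  define p where "p = nat (x - 1) + i"
  have "- (phi (complex_of_real q) 0 i x) = (- 1) ^ Suc i * of_nat (p choose i)"
  proof -
    have "phi (complex_of_real q) 0 i x = (- 1) ^ i * (of_int x + of_nat i - 1 gchoose i)"
      by (simp add: phi_0 gbinomial_minus)
    also have "of_int x + of_nat i - 1 = (of_nat p :: complex)"
      using 0 by (simp add: p_def)
    finally show ?thesis by (simp add: binomial_gbinomial)
  qed
  then have "((\<lambda>z. z ^ p / (1 - z) ^ Suc i) has_contour_integral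
      - (2 * of_real pi * \<i>) * phi (complex_of_real q) 0 i x) (circlepath 0 r)"
    using has_contour_integral_power_over_pole[OF r, of p "Suc i"] by simp
  then show ?case
  proof (rule has_contour_integral_eq)
    fix z assume "z \<in> path_image (circlepath 0 r)"
    then have "z \<noteq> 0" using r by (auto simp: path_image_circlepath)
    then have "z powi (x - 2) * z powi (int (Suc i)) = z powi (x - 2 + int (Suc i))"
      by (subst power_int_add) auto
    also have "x - 2 + int (Suc i) = int p" using 0 by (simp add: p_def)
    finally have "z powi (x - 2) * z ^ Suc i = z ^ p"
      by (simp only: power_int_of_nat)
    then show "z ^ p / (1 - z) ^ Suc i = z powi (x - 2) * (z / (1 - z)) ^ Suc i * (1 - of_real q * z) ^ 0"
      by (simp add: power_divide)
  qed
next
  case (Suc m)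
  let ?Q = "complex_of_real q"
  let ?f = "\<lambda>m x z. z powi (x - 2) * (z / (1 - z)) ^ Suc i * (1 - ?Q * z) ^ m"
  have "((\<lambda>z. ?f m x z - ?Q * ?f m (x + 1) z) has_contour_integral
      (- (2 * of_real pi * \<i>) * phi ?Q m i x) - ?Q * (- (2 * of_real pi * \<i>) * phi ?Q m i (x + 1))) (circlepath 0 r)"
    by (intro has_contour_integral_diff has_contour_integral_lmul Suc.IH) (use Suc.prems in auto)
  then have "(?f (Suc m) x has_contour_integral
      (- (2 * of_real pi * \<i>) * phi ?Q m i x) - ?Q * (- (2 * of_real pi * \<i>) * phi ?Q m i (x + 1))) (circlepath 0 r)"
  proof (rule has_contour_integral_eq)
    fix z assume "z \<in> path_image (circlepath 0 r)"
    then have "z \<noteq> 0" using r by (auto simp: path_image_circlepath)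
    then have "z powi (x + 1 - 2) = z * z powi (x - 2)"
      using power_int_add[of z 1 "x - 2"] by (simp add: add.commute)
    then show "?f m x z - ?Q * ?f m (x + 1) z = ?f (Suc m) x z"
      by (simp only: power_Suc) (simp add: algebra_simps)
  qed
  then show ?case by (simp add: phi_Suc_m algebra_simps)
qed

lemma holomorphic_on_Cauchy_transform:
  assumes f: "continuous_on (sphere 0 r) f"
  shows "(\<lambda>z. contour_integral (circlepath 0 r) (\<lambda>w. f w / (w - z))) holomorphic_on ball 0 r"
proof -
  let ?F = "\<lambda>z. contour_integral (circlepath 0 r) (\<lambda>w. f w / (w - z))"
  have int: "((\<lambda>w. f w / (w - z) ^ 1) has_contour_integral ?F z) (circlepath 0 r)" if "z \<in> ball 0 r" for z
  proof -
    have "0 < r" using that norm_ge_zero[of z] by (simp del: norm_ge_zero)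
    then have "(\<lambda>w. f w / (w - z)) contour_integrable_on circlepath 0 r"
      using that f by (intro contour_integrable_continuous_circlepath continuous_intros) auto
    then show ?thesis by (simp add: has_contour_integral_integral)
  qed
  have cont: "continuous_on (path_image (circlepath 0 r)) f" if "0 < r"
    using f that by simp
  show ?thesis
  proof (rule holomorphic_onI)
    fix z :: complex assume z: "z \<in> ball 0 r"
    then have "0 < r" using norm_ge_zero[of z] by (simp del: norm_ge_zero)
    from Cauchy_next_derivative_circlepath(2)[OF cont[OF this] int _ z]
    show "?F field_differentiable (at z within ball 0 r)"
      using field_differentiable_at_within field_differentiable_def by blast
  qed
qed

text \<open>
  The finite geometric sum for \<open>1 / (w - z)\<close> in the ratio \<open>t = u / v\<close>, where \<open>u = 1 / w - 1\<close> and \<open>v = 1 / z - 1\<close>. In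
  the terms of the sum the variables separate; in the remainder the factor \<open>(1 - z)\<^sup>n\<close> has cancelled.
\<close>

lemma kernel_split:
  fixes w z Q :: complex and x y :: int
  assumes w: "w \<noteq> 0" "1 - Q * w \<noteq> 0" and z: "z \<noteq> 0" "1 - z \<noteq> 0" and wz: "w \<noteq> z"
  shows "1 / w * (w / (w - z) * (z powi (x + int n) / w powi (y + int n)) *
          (((1 - Q * z) ^ m * (1 - w) ^ n) / ((1 - z) ^ n * (1 - Q * w) ^ m))) =
     (\<Sum>i<n. - (z * (z powi (x - 2) * (z / (1 - z)) ^ Suc i * (1 - Q * z) ^ m)) *
        ((1 / w - 1) ^ i * w powi (- y - 1) / (1 - Q * w) ^ m)) +
     z powi x * (1 - Q * z) ^ m * (w powi (- y) / (1 - Q * w) ^ m / (w - z))"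
proof -
  define t where "t = (1 / w - 1) * (z / (1 - z))"
  define c where "c = z powi x * w powi (- y) * ((1 - Q * z) ^ m / (1 - Q * w) ^ m)"
  have t1: "t - 1 = - (w - z) / (w * (1 - z))"
    using w z by (simp add: t_def divide_simps) (simp add: algebra_simps)
  have "1 / w * (w / (w - z) * (z powi (x + int n) / w powi (y + int n)) *
          (((1 - Q * z) ^ m * (1 - w) ^ n) / ((1 - z) ^ n * (1 - Q * w) ^ m))) =
     c * (t ^ n / (w - z))"
  proof -
    have u: "1 / w - 1 = (1 - w) / w" using w by (simp add: diff_divide_distrib)
    have tn: "t ^ n = (1 - w) ^ n / w ^ n * (z ^ n / (1 - z) ^ n)"
      by (simp only: t_def u power_mult_distrib power_divide)
    have powi: "z powi (x + int n) = z powi x * z ^ n" "w powi (y + int n) = w powi y * w ^ n"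
      using w z by (simp_all add: power_int_add)
    show ?thesis
      unfolding tn powi c_def power_int_minus using w z wz by (simp add: field_simps)
  qed
  also have "t ^ n / (w - z) = (t - 1) / (w - z) * (\<Sum>i<n. t ^ i) + 1 / (w - z)"
  proof -
    have "t ^ n = (t - 1) * (\<Sum>i<n. t ^ i) + 1"
      using power_diff_1_eq[of t n] by (metis diff_add_cancel)
    then show ?thesis by (simp only: add_divide_distrib times_divide_eq_left)
  qed
  also have "(t - 1) / (w - z) = - (1 / (w * (1 - z)))"
    unfolding t1 using w z wz by (simp add: divide_simps)
  also have "c * (- (1 / (w * (1 - z))) * (\<Sum>i<n. t ^ i) + 1 / (w - z)) =
     (\<Sum>i<n. c * (- (1 / (w * (1 - z))) * t ^ i)) + c * (1 / (w - z))"
    by (simp only: distrib_left sum_distrib_left)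
  also have "c * (1 / (w - z)) = z powi x * (1 - Q * z) ^ m * (w powi (- y) / (1 - Q * w) ^ m / (w - z))"
    by (simp add: c_def)
  also have "(\<Sum>i<n. c * (- (1 / (w * (1 - z))) * t ^ i)) =
     (\<Sum>i<n. - (z * (z powi (x - 2) * (z / (1 - z)) ^ Suc i * (1 - Q * z) ^ m)) *
        ((1 / w - 1) ^ i * w powi (- y - 1) / (1 - Q * w) ^ m))"
  proof (intro sum.cong refl)
    fix i
    have zx: "z powi x = z * (z * z powi (x - 2))"
    proof -
      have e: "x = 1 + (1 + (x - 2))" by simp
      show ?thesis by (subst e, subst power_int_add, use z in simp, subst power_int_add) (use z in simp_all)
    qed
    have wy: "w powi (- y) = w * w powi (- y - 1)"
    proof -
      have e: "- y = 1 + (- y - 1)" by simp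
      show ?thesis by (subst e, subst power_int_add) (use w in simp_all)
    qed
    show "c * (- (1 / (w * (1 - z))) * t ^ i) =
      - (z * (z powi (x - 2) * (z / (1 - z)) ^ Suc i * (1 - Q * z) ^ m)) *
        ((1 / w - 1) ^ i * w powi (- y - 1) / (1 - Q * w) ^ m)"
      unfolding c_def zx wy t_def power_mult_distrib power_Suc using w z by (simp add: mult_ac)
  qed
  finally show ?thesis .
qed

text \<open>
  Integrating the remainder of \<open>kernel_split\<close> over \<open>w\<close> leaves a function of \<open>z\<close> that is holomorphic inside
  \<open>r1\<close>, because \<open>x \<ge> 1\<close> excludes a pole at \<open>0\<close>. Its integral over the smaller circle therefore vanishes.
\<close>

lemma lpp_kernel_eq_sum:
  assumes q: "0 < q" and r: "1 < r2" "r2 < r1" "r1 < 1 / q" and x: "1 \<le> x"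
  shows "lpp_kernel q r1 r2 m n x y = (\<Sum>i<n. phi (complex_of_real q) m i x * psi (complex_of_real q) m i y)"
proof -
  let ?Q = "complex_of_real q" and ?pi = "2 * of_real pi * \<i>"
  define A where "A i z = z powi (x - 2) * (z / (1 - z)) ^ Suc i * (1 - ?Q * z) ^ m" for i z
  define B where "B i w = (1 / w - 1) ^ i * w powi (- y - 1) / (1 - ?Q * w) ^ m" for i w
  define f where "f w = w powi (- y) / (1 - ?Q * w) ^ m" for w
  define F where "F z = contour_integral (circlepath 0 r1) (\<lambda>w. f w / (w - z))" for z
  have w: "w \<noteq> 0" "1 - ?Q * w \<noteq> 0" if "norm w = r1" for w
  proof -
    show "w \<noteq> 0" using that r by auto
    have "norm (?Q * w) < 1" using that q r by (simp add: norm_mult field_simps)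
    then show "1 - ?Q * w \<noteq> 0" by auto
  qed
  have cont: "continuous_on (sphere 0 r1) f"
    unfolding f_def using w by (intro continuous_intros) auto
  have inner: "contour_integral (circlepath 0 r1) (\<lambda>w. 1 / w *
         (w / (w - z) * (z powi (x + int n) / w powi (y + int n)) *
          (((1 - ?Q * z) ^ m * (1 - w) ^ n) / ((1 - z) ^ n * (1 - ?Q * w) ^ m)))) =
      (\<Sum>i<n. - (z * A i z) * (?pi * psi ?Q m i y)) + z powi x * (1 - ?Q * z) ^ m * F z"
    if z: "norm z = r2" for z
  proof (rule contour_integral_unique)
    have "(\<lambda>w. f w / (w - z)) contour_integrable_on circlepath 0 r1"
      using cont z r by (intro contour_integrable_continuous_circlepath continuous_intros) auto
    then have "((\<lambda>w. f w / (w - z)) has_contour_integral F z) (circlepath 0 r1)"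
      unfolding F_def by (rule has_contour_integral_integral)
    moreover have "(B i has_contour_integral ?pi * psi ?Q m i y) (circlepath 0 r1)" for i
      unfolding B_def using has_contour_integral_psi[OF q, of r1 i y m] r by simp
    ultimately have "((\<lambda>w. (\<Sum>i<n. - (z * A i z) * B i w) + z powi x * (1 - ?Q * z) ^ m * (f w / (w - z)))
        has_contour_integral
        (\<Sum>i<n. - (z * A i z) * (?pi * psi ?Q m i y)) + z powi x * (1 - ?Q * z) ^ m * F z) (circlepath 0 r1)"
      by (intro has_contour_integral_add has_contour_integral_sum has_contour_integral_lmul) auto
    then show "((\<lambda>w. 1 / w *
         (w / (w - z) * (z powi (x + int n) / w powi (y + int n)) *
          (((1 - ?Q * z) ^ m * (1 - w) ^ n) / ((1 - z) ^ n * (1 - ?Q * w) ^ m)))) has_contour_integral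
        (\<Sum>i<n. - (z * A i z) * (?pi * psi ?Q m i y)) + z powi x * (1 - ?Q * z) ^ m * F z) (circlepath 0 r1)"
    proof (rule has_contour_integral_eq)
      fix w' :: complex assume "w' \<in> path_image (circlepath 0 r1)"
      then have w': "norm w' = r1" using r by simp
      have "z \<noteq> 0" "1 - z \<noteq> 0" "w' \<noteq> z" using z w' r by auto
      from kernel_split[OF w[OF w'] this, where n = n and m = m and x = x and y = y]
      show "(\<Sum>i<n. - (z * A i z) * B i w') + z powi x * (1 - ?Q * z) ^ m * (f w' / (w' - z)) =
         1 / w' * (w' / (w' - z) * (z powi (x + int n) / w' powi (y + int n)) *
          (((1 - ?Q * z) ^ m * (1 - w') ^ n) / ((1 - z) ^ n * (1 - ?Q * w') ^ m)))"
        unfolding A_def B_def f_def by simp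
    qed
  qed
  have "((\<lambda>z. z ^ nat (x - 1) * (1 - ?Q * z) ^ m * F z) has_contour_integral 0) (circlepath 0 r2)"
    by (rule has_contour_integral_circle_holomorphic[of _ r1])
       (use r holomorphic_on_Cauchy_transform[OF cont] in \<open>auto intro!: holomorphic_intros simp: F_def\<close>)
  moreover have "(A i has_contour_integral - ?pi * phi ?Q m i x) (circlepath 0 r2)" for i
    unfolding A_def using has_contour_integral_phi[OF r(1) x, of i q m] by simp
  ultimately have "((\<lambda>z. (\<Sum>i<n. - (?pi * psi ?Q m i y) * A i z) + z ^ nat (x - 1) * (1 - ?Q * z) ^ m * F z)
      has_contour_integral (\<Sum>i<n. - (?pi * psi ?Q m i y) * (- ?pi * phi ?Q m i x)) + 0) (circlepath 0 r2)"
    by (intro has_contour_integral_add has_contour_integral_sum has_contour_integral_lmul) auto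
  then have "((\<lambda>z. 1 / z * contour_integral (circlepath 0 r1) (\<lambda>w. 1 / w *
         (w / (w - z) * (z powi (x + int n) / w powi (y + int n)) *
          (((1 - ?Q * z) ^ m * (1 - w) ^ n) / ((1 - z) ^ n * (1 - ?Q * w) ^ m)))))
      has_contour_integral (\<Sum>i<n. - (?pi * psi ?Q m i y) * (- ?pi * phi ?Q m i x)) + 0) (circlepath 0 r2)"
  proof (rule has_contour_integral_eq)
    fix z :: complex assume "z \<in> path_image (circlepath 0 r2)"
    then have z: "norm z = r2" using r by simp
    then have z0: "z \<noteq> 0" using r by auto
    have "z powi x = z * z ^ nat (x - 1)"
      using x z0 power_int_add[of z 1 "x - 1"] by (simp add: power_int_def)
    then show "(\<Sum>i<n. - (?pi * psi ?Q m i y) * A i z) + z ^ nat (x - 1) * (1 - ?Q * z) ^ m * F z =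
       1 / z * contour_integral (circlepath 0 r1) (\<lambda>w. 1 / w *
         (w / (w - z) * (z powi (x + int n) / w powi (y + int n)) *
          (((1 - ?Q * z) ^ m * (1 - w) ^ n) / ((1 - z) ^ n * (1 - ?Q * w) ^ m))))"
      unfolding inner[OF z] distrib_left sum_distrib_left using z0
      by (intro arg_cong2[where f = "(+)"] sum.cong) simp_all
  qed
  then have "lpp_kernel q r1 r2 m n x y =
      1 / ?pi\<^sup>2 * (\<Sum>i<n. - (?pi * psi ?Q m i y) * (- ?pi * phi ?Q m i x))"
    unfolding lpp_kernel_def by (simp add: contour_integral_unique)
  also have "\<dots> = (\<Sum>i<n. phi ?Q m i x * psi ?Q m i y)"
    unfolding sum_distrib_left by (intro sum.cong refl) (simp add: power2_eq_square field_simps)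
  finally show ?thesis .
qed

section \<open>The Fredholm determinant formula\<close>

theorem proposition2p5:
  fixes M :: "'a measure"
    and w :: "nat \<Rightarrow> nat \<Rightarrow> 'a \<Rightarrow> nat"
    and q r1 r2 :: real
    and m n \<eta> :: nat
  assumes "prob_space M"
    and "prob_space.indep_vars M (\<lambda>_. count_space UNIV) (\<lambda>(i, j). w i j) ({1..} \<times> {1..})"
    and "\<And>i j k. 1 \<le> i \<Longrightarrow> 1 \<le> j \<Longrightarrow>
           measure M {\<omega> \<in> space M. w i j \<omega> = k} = (1 - q) * q ^ k"
    and "0 < q" "q < 1"
    and "1 < r2" "r2 < r1" "r1 < 1 / q"
    and "1 \<le> n" "n \<le> m"
  shows "fredholm_convergent (lpp_kernel q r1 r2 m n) {int \<eta> + 1..} \<and>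
         complex_of_real
           (measure M {\<omega> \<in> space M. last_passage (\<lambda>i j. w i j \<omega>) m n \<le> \<eta>}) =
         fredholm_det (lpp_kernel q r1 r2 m n) {int \<eta> + 1..}"
proof -
  interpret prob_space M by fact
  let ?Q = "complex_of_real q" and ?S = "{int \<eta> + 1..}"
  note q = \<open>0 < q\<close> \<open>q < 1\<close>
  have K: "lpp_kernel q r1 r2 m n x y = (\<Sum>l<n. phi ?Q m l x * psi ?Q m l y)"
    if "x \<in> ?S" "y \<in> ?S" for x y
    by (rule lpp_kernel_eq_sum) (use that assms in auto)
  have sm: "(\<lambda>x. norm (psi ?Q m i x * phi ?Q m j x)) summable_on ?S" for i j
    by (rule summable_on_subset_banach[OF abs_summable_psi_phi[OF q]]) simp
  have S: "countable ?S" by simp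
  note fredholm = fredholm_det_finite_rank[where S = ?S and n = n and g = "phi ?Q m" and p = "psi ?Q m"
      and K = "lpp_kernel q r1 r2 m n", OF K S sm]
  have "complex_of_real (prob {\<omega> \<in> space M. last_passage (\<lambda>i j. w i j \<omega>) m n \<le> \<eta>}) =
      complex_of_real (prob {\<omega> \<in> space M. lpp (\<lambda>i j. w i j \<omega>) m n \<le> \<eta>})"
    using assms by (simp only: last_passage_eq_lpp order.trans[of 1 n m])
  also have "\<dots> = Determinant.det (mat n n (\<lambda>(j, i). neg_binomial_diff ?Q m (int j - int i - 1) (int \<eta> + 1)))"
    by (rule lpp_distribution_eq_det) (use assms in auto)
  also have "\<dots> = Determinant.det (mat n n (\<lambda>(j, i). \<Sum>x\<in>{- int n..int \<eta>}. psi ?Q m j x * phi ?Q m i x))"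
    by (rule det_neg_binomial_diff_eq_psi_phi) (use q in auto)
  also have "mat n n (\<lambda>(j, i). \<Sum>x\<in>{- int n..int \<eta>}. psi ?Q m j x * phi ?Q m i x) =
      mat n n (\<lambda>(j, i). (if j = i then 1 else 0) - (\<Sum>\<^sub>\<infinity>x\<in>?S. psi ?Q m j x * phi ?Q m i x))"
    by (rule eq_matI) (use sum_psi_phi_eq[OF q] in auto)
  also have "Determinant.det \<dots> = fredholm_det (lpp_kernel q r1 r2 m n) ?S"
    by (rule fredholm(2)[symmetric])
  finally show ?thesis using fredholm(1) by blast
qed

end
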